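(* Let $F$ be a formula in 2-XNF in the variables $X_1,\dots,X_n$ with an implication graph structure $(L,V,E)$, and let $\sigma$ be a term ordering. Then the recursive procedure $\mathrm{SOLVER}_\sigma$ (described in the context), applied to $(L,V,E)$, terminates after finitely many steps; it returns UNSAT if and only if $\mathcal{S}(F)=\emptyset$, and otherwise it returns an element $a\in\mathcal{S}(F)$.
   Context: $\mathbb{B}_n=\mathbb{F}_2[X_1,\dots,X_n]/\langle X_1^2-X_1,\dots,X_n^2-X_n\rangle$ is the ring of Boolean polynomials, $x_i$ the residue class of $X_i$, and $\mathbb{L}_n=\langle 1,x_1,\dots,x_n\rangle_{\mathbb{F}_2}$ the space of linear Boolean polynomials. $\mathcal{Z}(S)\subseteq\mathbb{F}_2^n$ is the set of common zeros of $S\subseteq\mathbb{B}_n$. A term ordering $\sigma$ on $\mathbb{F}_2[X_1,\dots,X_n]$ induces an ordering on the square-free terms of $\mathbb{B}_n$, and $\mathrm{LT}_\sigma(f)$ is the largest term in the support of $f\neq 0$. $\mathrm{NR}_\sigma(f,L)$ is the normal remainder of $f$ under the division algorithm by the elements of $L$ with respect to $\sigma$ (performed on the canonical square-free representatives). A lineral is an XOR of literals; a formula is in 2-XNF if it is a conjunction of clauses each of which is a disjunction of at most two linerals. For such a formula $F$ in $X_1,\dots,X_n$ (true $=1$, false $=0$), $\mathcal{S}(F)\subseteq\mathbb{F}_2^n$ is its set of satisfying assignments, and $I_F\subseteq\mathbb{B}_n$ is the unique ideal with $\mathcal{Z}(I_F)=\mathcal{S}(F)$. An implication graph structure (IGS)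 for $F$ is a tuple $(L,V,E)$ with $L,V\subseteq\mathbb{L}_n$ and $E\subseteq V^2$ such that (1) $I_F=\langle L\rangle+\langle fg\mid (f+1,g)\in E\rangle$; (2) for all $(f+1,g)\in E$ we have $(g+1,f)\in E$; (3) for all $f\in V$, $(f,f)\notin E$. A path $f\to g$ is a sequence $f=f_1,\dots,f_s=g$ in $V$ with $(f_i,f_{i+1})\in E$ for $1\le i\le s-1$. For $f\in V$ let $D_f=\{f\}\cup\{g\in V\mid\text{there is a path } f\to g\}$. Procedure $\mathrm{GGCP}_\sigma(G)$: Line 1: Write $G=(L,V,E)$ and replace $L$ by an $\mathbb{F}_2$-basis of $\langle L\rangle_{\mathbb{F}_2}$ whose elements have pairwise distinct leading terms. Line 2: Let $(L',V',E')=(L,\emptyset,\emptyset)$. Lines 3-8: For each $(f,g)\in E$: let $f'=\mathrm{NR}_\sigma(f,L)$ and $g'=\mathrm{NR}_\sigma(g,L)$; if $f'=0$ and $g'\ne0$, append $g'$ to $L'$; if $g'=1$ and $f'\neq1$, append $f'+1$ to $L'$; if $f'\notin\mathbb{F}_2$ and $g'\notin\mathbb{F}_2$ and $f'\ne g'$, append $(f',g')$ to $E'$ and append $f'$ and $g'$ to $V'$. Line 9: If $L\ne L'$, set $G=(L',V',E')$ and go to Line 1. Line 10: Otherwise return $(L',V',E')$. Procedure $\mathrm{crGGCP}_\sigma(G)$: Line 1: Compute $(L',V',E')=\mathrm{GGCP}_\sigma(G)$ and let $L_{SCC}=\emptyset$. Line 2: Compute the set $\mathcal{C}$ of all strongly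 connected components of $(V',E')$ (single vertices allowed). Line 3: If $\#\mathcal{C}$ is odd, return $(\{1,x_1,\dots,x_n\},\emptyset,\emptyset)$. Lines 4-5: For each $S=\{f_1,\dots,f_r\}\in\mathcal{C}$ append $f_1+f_i$ to $L_{SCC}$ for all $i\in\{2,\dots,r\}$. Line 6: If $L_{SCC}\neq\emptyset$, set $G=(L'\cup L_{SCC},V',E')$ and go to Line 1. Line 7: Otherwise return $(L',V',E')$. $\mathrm{tFLS}(L,V,E)$, for an acyclic IGS, returns the set of all trivial failed linerals, i.e. of all $f\in V$ for which there is a path $f\to f+1$, or there is $g\in V$ with paths $f\to g$ and $f\to g+1$. Decisions: for an IGS $(L,V,E)$ of the kind returned by $\mathrm{crGGCP}_\sigma$ with $E\neq\emptyset$, a pair $(L_0,L_1)$ of subsets of $\mathbb{L}_n$ is computed by one of the following heuristics. MaxReach: $(D_f,\{f+1\})$ where $f\in V$ is a source (vertex without incoming edges) such that the number of paths starting at $f$ is maximal. MaxBottleneck: $(D_f,D_{f+1})$ where $f\in V$ maximizes the number of paths ending in $f$ plus the number of paths starting at $f$. MaxPath: $(\{f_1+f_i\mid 1\le i\le r\},\{f_1+1,f_r\})$ where $f_1,\dots,f_r$ (with $(f_i,f_{i+1})\in E$) is a path of maximal length in $(V,E)$. Procedure $\mathrm{SOLVER}_\sigma(L,V,E)$: Line 1: Let $(L,V,E)=\mathrm{crGGCP}_\sigma(L,V,E)$. Line 2: Let $L_{FL}=\mathrm{tFLS}(L,V,E)$ and adjoin $1+L_{FL}=\{f+1\mid f\in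 L_{FL}\}$ to $L$. Line 3: If $L_{FL}\neq\emptyset$, go to Line 1. Line 4: If $1\in\langle L\rangle_{\mathbb{F}_2}$, return UNSAT. Line 5: If $E=\emptyset$, return some $a\in\mathcal{Z}(L)\subseteq\mathbb{F}_2^n$. Line 6: Compute a decision $(L_0,L_1)$ for $(L,V,E)$ with one of the heuristics above. Line 7: If $\mathrm{SOLVER}_\sigma(L\cup L_0,V,E)$ returns some $a\in\mathbb{F}_2^n$, return $a$. Line 8: Otherwise return the result of $\mathrm{SOLVER}_\sigma(L\cup L_1,V,E)$. *)

theory Defs
  imports
    "HOL-Analysis.Finite_Cartesian_Product"
    "HOL-Library.Poly_Mapping"
    "HOL-Library.Z2"
    "HOL-Library.While_Combinator"
begin

text \<open>
  The indeterminates are indexed by a finite type \<open>'n\<close>, so that \<open>n = CARD('n)\<close>.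
  A term is an exponent vector \<open>'n \<Rightarrow>\<^sub>0 nat\<close> (written additively, with \<open>0\<close> for the
  term \<open>1\<close>), a point of the affine space over the two-element field is a vector \<open>bit ^ 'n\<close>.
\<close>

section \<open>Boolean polynomials\<close>

type_synonym 'n pterm = "'n \<Rightarrow>\<^sub>0 nat"
type_synonym 'n f2poly = "'n pterm \<Rightarrow>\<^sub>0 bit"

interpretation ideal: module "(*) :: 'a::comm_ring_1 \<Rightarrow> 'a \<Rightarrow> 'a"
  by standard (simp_all add: algebra_simps)

(* as a rewrite rule it is the reverse of mult.assoc *)
declare ideal.scale_scale [simp del]

definition indet :: "'n \<Rightarrow> 'n f2poly" where
  "indet i = Poly_Mapping.single (Poly_Mapping.single i 1) 1"

definition field_ideal :: "'n f2poly set" where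
  "field_ideal = ideal.span {indet i ^ 2 - indet i | i. True}"

lemma field_ideal_zero: "0 \<in> field_ideal"
  unfolding field_ideal_def by (rule ideal.span_zero)

lemma field_ideal_add: "p \<in> field_ideal \<Longrightarrow> q \<in> field_ideal \<Longrightarrow> p + q \<in> field_ideal"
  unfolding field_ideal_def by (rule ideal.span_add)

lemma field_ideal_uminus: "p \<in> field_ideal \<Longrightarrow> - p \<in> field_ideal"
  unfolding field_ideal_def by (rule ideal.span_neg)

lemma field_ideal_mult: "p \<in> field_ideal \<Longrightarrow> c * p \<in> field_ideal"
  unfolding field_ideal_def by (rule ideal.span_scale)

lemma lookup_mult_zero:
  fixes p q :: "'n pterm \<Rightarrow>\<^sub>0 'a::comm_ring_1"
  shows "Poly_Mapping.lookup (p * q) 0 = Poly_Mapping.lookup p 0 * Poly_Mapping.lookup q 0"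
proof -
  have eq: "0 = a + b \<longleftrightarrow> b = 0 \<and> a = 0" for a b :: "'n pterm"
    by (auto simp: poly_mapping_eq_iff fun_eq_iff lookup_add)
  have "Poly_Mapping.lookup (p * q) 0 =
      (\<Sum>a. Poly_Mapping.lookup p a * (\<Sum>b. (Poly_Mapping.lookup q b when a = 0) when b = 0))"
    by (simp add: times_poly_mapping.rep_eq prod_fun_def eq when_when conj_commute)
  also have "\<dots> = (\<Sum>a. (Poly_Mapping.lookup p a * Poly_Mapping.lookup q 0) when a = 0)"
    by (simp add: mult_when cong: when_cong)
  finally show ?thesis by simp
qed

lemma one_notin_field_ideal: "(1 :: 'n f2poly) \<notin> field_ideal"
proof
  assume "(1 :: 'n f2poly) \<in> field_ideal"
  moreover have "field_ideal \<subseteq> {p :: 'n f2poly. Poly_Mapping.lookup p 0 = 0}"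
    unfolding field_ideal_def
  proof (rule ideal.span_minimal)
    show "ideal.subspace {p :: 'n f2poly. Poly_Mapping.lookup p 0 = 0}"
      by (auto simp: ideal.subspace_def lookup_add lookup_mult_zero)
    have "Poly_Mapping.lookup (indet i) (0 :: 'n pterm) = 0" for i
    proof -
      have "Poly_Mapping.single i (1 :: nat) \<noteq> 0"
        by (metis lookup_single_eq lookup_zero zero_neq_one)
      then show ?thesis by (simp add: indet_def lookup_single when_def)
    qed
    then show "{indet i ^ 2 - indet i | i :: 'n. True} \<subseteq> {p. Poly_Mapping.lookup p 0 = 0}"
      by (auto simp: power2_eq_square lookup_minus lookup_mult_zero)
  qed
  ultimately show False by auto
qed

quotient_type (overloaded) 'n bpoly = "'n f2poly" / "\<lambda>p q. p - q \<in> field_ideal"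
  morphisms rep_bpoly abs_bpoly
proof (rule equivpI)
  show "reflp (\<lambda>p q. p - q \<in> (field_ideal :: 'n f2poly set))"
    by (rule reflpI) (simp add: field_ideal_zero)
  show "symp (\<lambda>p q. p - q \<in> (field_ideal :: 'n f2poly set))"
  proof (rule sympI)
    show "q - p \<in> field_ideal" if "p - q \<in> field_ideal" for p q :: "'n f2poly"
      using field_ideal_uminus[OF that] by simp
  qed
  show "transp (\<lambda>p q. p - q \<in> (field_ideal :: 'n f2poly set))"
  proof (rule transpI)
    show "p - r \<in> field_ideal" if "p - q \<in> field_ideal" "q - r \<in> field_ideal" for p q r :: "'n f2poly"
      using field_ideal_add[OF that] by simp
  qed
qed

instantiation bpoly :: (type) comm_ring_1
begin

lift_definition zero_bpoly :: "'n bpoly" is 0 .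
lift_definition one_bpoly :: "'n bpoly" is 1 .
lift_definition plus_bpoly :: "'n bpoly \<Rightarrow> 'n bpoly \<Rightarrow> 'n bpoly" is "(+)"
proof -
  fix p q r s :: "'n f2poly"
  assume "p - q \<in> field_ideal" "r - s \<in> field_ideal"
  moreover have "p + r - (q + s) = (p - q) + (r - s)" by simp
  ultimately show "p + r - (q + s) \<in> field_ideal" by (simp only: field_ideal_add)
qed
lift_definition uminus_bpoly :: "'n bpoly \<Rightarrow> 'n bpoly" is uminus
proof -
  fix p q :: "'n f2poly"
  assume "p - q \<in> field_ideal"
  from field_ideal_uminus[OF this] show "- p - - q \<in> field_ideal" by simp
qed
lift_definition minus_bpoly :: "'n bpoly \<Rightarrow> 'n bpoly \<Rightarrow> 'n bpoly" is "(-)"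
proof -
  fix p q r s :: "'n f2poly"
  assume "p - q \<in> field_ideal" "r - s \<in> field_ideal"
  moreover have "p - r - (q - s) = (p - q) + - (r - s)" by simp
  ultimately show "p - r - (q - s) \<in> field_ideal" by (simp only: field_ideal_add field_ideal_uminus)
qed
lift_definition times_bpoly :: "'n bpoly \<Rightarrow> 'n bpoly \<Rightarrow> 'n bpoly" is "(*)"
proof -
  fix p q r s :: "'n f2poly"
  assume "p - q \<in> field_ideal" "r - s \<in> field_ideal"
  moreover have "p * r - q * s = r * (p - q) + q * (r - s)" by (simp add: algebra_simps)
  ultimately show "p * r - q * s \<in> field_ideal" by (simp only: field_ideal_add field_ideal_mult)
qed

instance
proof
  fix a b c :: "'n bpoly"
  show "a + b + c = a + (b + c)" by transfer (simp add: add.assoc field_ideal_zero)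
  show "a + b = b + a" by transfer (simp add: field_ideal_zero)
  show "0 + a = a" by transfer (simp add: field_ideal_zero)
  show "- a + a = 0" by transfer (simp add: field_ideal_zero)
  show "a - b = a + - b" by transfer (simp add: field_ideal_zero)
  show "a * b * c = a * (b * c)" by transfer (simp add: mult.assoc field_ideal_zero)
  show "a * b = b * a" by transfer (simp add: mult.commute field_ideal_zero)
  show "1 * a = a" by transfer (simp add: field_ideal_zero)
  show "(a + b) * c = a * c + b * c" by transfer (simp add: distrib_right field_ideal_zero)
  show "(0 :: 'n bpoly) \<noteq> 1"
  proof transfer
    show "(0 :: 'n f2poly) - 1 \<notin> field_ideal"
      using field_ideal_uminus[of "- 1"] one_notin_field_ideal by auto
  qed
qed

end

lift_definition bconst :: "bit \<Rightarrow> 'n bpoly" is "Poly_Mapping.single 0" .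
lift_definition bvar :: "'n \<Rightarrow> 'n bpoly" is indet .

definition bscale :: "bit \<Rightarrow> 'n bpoly \<Rightarrow> 'n bpoly" where
  "bscale c f = bconst c * f"

interpretation F2: vector_space bscale
proof
  fix a b :: bit and x y :: "'n bpoly"
  have add: "bconst (a + b) = bconst a + (bconst b :: 'n bpoly)"
    by transfer (simp only: single_add diff_self field_ideal_zero)
  have mult: "bconst (a * b) = bconst a * (bconst b :: 'n bpoly)"
    by transfer (simp only: mult_single add_0 diff_self field_ideal_zero)
  have one: "bconst 1 = (1 :: 'n bpoly)"
    by transfer (simp only: single_one diff_self field_ideal_zero)
  show "bscale a (x + y) = bscale a x + bscale a y"
    by (simp only: bscale_def distrib_left)
  show "bscale (a + b) x = bscale a x + bscale b x"
    by (simp only: bscale_def add distrib_right)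
  show "bscale a (bscale b x) = bscale (a * b) x"
    by (simp only: bscale_def mult mult.assoc)
  show "bscale 1 x = x"
    by (simp only: bscale_def one mult_1_left)
qed

definition linear_bpolys :: "'n bpoly set" where
  "linear_bpolys = F2.span (insert 1 (range bvar))"

definition term_val :: "'a::comm_ring_1 ^ 'n \<Rightarrow> 'n pterm \<Rightarrow> 'a" where
  "term_val a t = (\<Prod>i\<in>UNIV. (a $ i) ^ Poly_Mapping.lookup t i)"

definition poly_val :: "'a::comm_ring_1 ^ 'n \<Rightarrow> ('n pterm \<Rightarrow>\<^sub>0 'a) \<Rightarrow> 'a" where
  "poly_val a p = (\<Sum>t\<in>Poly_Mapping.keys p. Poly_Mapping.lookup p t * term_val a t)"

lemma term_val_add: "term_val a (s + t) = term_val a s * term_val a t"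
  by (simp add: term_val_def lookup_add power_add prod.distrib)

lemma poly_val_superset:
  assumes "finite A" "Poly_Mapping.keys p \<subseteq> A"
  shows "poly_val a p = (\<Sum>t\<in>A. Poly_Mapping.lookup p t * term_val a t)"
  unfolding poly_val_def using assms
  by (intro sum.mono_neutral_left) (auto simp: in_keys_iff)

lemma poly_val_add: "poly_val a (p + q) = poly_val a p + poly_val a q"
proof -
  define A where "A = Poly_Mapping.keys p \<union> Poly_Mapping.keys q"
  have A: "finite A" "Poly_Mapping.keys p \<subseteq> A" "Poly_Mapping.keys q \<subseteq> A" "Poly_Mapping.keys (p + q) \<subseteq> A"
    using Poly_Mapping.keys_add[of p q] by (auto simp: A_def)
  then show ?thesis
    by (simp add: poly_val_superset[of A] lookup_add distrib_right sum.distrib)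
qed

lemma poly_val_zero [simp]: "poly_val a 0 = 0"
  by (simp add: poly_val_def)

lemma poly_val_single: "poly_val a (Poly_Mapping.single t c) = c * term_val a t"
  by (simp add: poly_val_def)

lemma poly_val_sum: "poly_val a (sum f A) = (\<Sum>x\<in>A. poly_val a (f x))"
  by (induction A rule: infinite_finite_induct) (simp_all add: poly_val_add)

lemma poly_val_times: "poly_val a (p * q) = poly_val a p * poly_val a q"
proof -
  have decomp: "r = (\<Sum>t\<in>Poly_Mapping.keys r. Poly_Mapping.single t (Poly_Mapping.lookup r t))"
    for r :: "'n::finite pterm \<Rightarrow>\<^sub>0 'a"
    by (rule poly_mapping_eqI) (simp add: lookup_sum lookup_single when_def in_keys_iff)
  have "p * q = (\<Sum>s\<in>Poly_Mapping.keys p. \<Sum>t\<in>Poly_Mapping.keys q.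
      Poly_Mapping.single (s + t) (Poly_Mapping.lookup p s * Poly_Mapping.lookup q t))"
    by (subst decomp[of p], subst decomp[of q]) (simp add: sum_product mult_single)
  then show ?thesis
    by (simp add: poly_val_sum poly_val_single sum_product term_val_add mult_ac poly_val_def[of a p] poly_val_def[of a q])
qed

lemma poly_val_diff: "poly_val a (p - q) = poly_val a p - poly_val a q"
  using poly_val_add[of a "p - q" q] by simp

lemma poly_val_field_ideal:
  assumes "p \<in> field_ideal" shows "poly_val a p = 0"
proof -
  have "field_ideal \<subseteq> {p. poly_val a p = 0}"
    unfolding field_ideal_def
  proof (rule ideal.span_minimal)
    show "ideal.subspace {p. poly_val a p = 0}"
      by (auto simp: ideal.subspace_def poly_val_add poly_val_times)
    have idem: "x * x - x = 0" for x :: bit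
      by (cases x) simp_all
    show "{indet i ^ 2 - indet i | i. True} \<subseteq> {p. poly_val a p = 0}"
      by (auto simp only: power2_eq_square poly_val_diff poly_val_times idem)
  qed
  with assms show ?thesis by blast
qed

lift_definition bval :: "bit ^ 'n \<Rightarrow> 'n bpoly \<Rightarrow> bit" is poly_val
proof -
  fix a :: "bit ^ 'n" and p q :: "'n f2poly"
  assume "p - q \<in> field_ideal"
  then show "poly_val a p = poly_val a q"
    using poly_val_field_ideal[of "p - q" a] by (simp only: poly_val_diff right_minus_eq)
qed

definition zeros :: "'n bpoly set \<Rightarrow> (bit ^ 'n) set" where
  "zeros S = {a. \<forall>f\<in>S. bval a f = 0}"


section \<open>Term orderings and normal remainders\<close>

text \<open>\<open>(s, t) \<in> \<sigma>\<close> means that \<open>s\<close> is less than or equal to \<open>t\<close>.\<close>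

definition term_ordering :: "'n pterm rel \<Rightarrow> bool" where
  "term_ordering \<sigma> \<longleftrightarrow> linear_order \<sigma> \<and> (\<forall>t. (0, t) \<in> \<sigma>) \<and>
     (\<forall>s t u. (s, t) \<in> \<sigma> \<longrightarrow> (s + u, t + u) \<in> \<sigma>)"

definition poly_LT :: "'n pterm rel \<Rightarrow> 'n f2poly \<Rightarrow> 'n pterm" where
  "poly_LT \<sigma> p = (THE t. t \<in> Poly_Mapping.keys p \<and> (\<forall>s\<in>Poly_Mapping.keys p. (s, t) \<in> \<sigma>))"

definition sqfree_rep :: "'n bpoly \<Rightarrow> 'n f2poly" where
  "sqfree_rep f = (THE p. abs_bpoly p = f \<and> (\<forall>t\<in>Poly_Mapping.keys p. \<forall>i. Poly_Mapping.lookup t i \<le> 1))"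

definition LT :: "'n pterm rel \<Rightarrow> 'n bpoly \<Rightarrow> 'n pterm" where
  "LT \<sigma> f = poly_LT \<sigma> (sqfree_rep f)"

text \<open>
  One step of the division algorithm by the tuple \<open>gs\<close>. In a state \<open>(v, r)\<close>, the polynomial \<open>v\<close>
  remains to be divided and \<open>r\<close> is the part of the remainder found so far. All leading
  coefficients are \<open>1\<close>. The quotients are not recorded.
\<close>

definition div_step :: "'n pterm rel \<Rightarrow> 'n f2poly list \<Rightarrow> 'n f2poly \<times> 'n f2poly \<Rightarrow> 'n f2poly \<times> 'n f2poly" where
  "div_step \<sigma> gs = (\<lambda>(v, r).
     case List.find (\<lambda>g. g \<noteq> 0 \<and> (\<exists>u. poly_LT \<sigma> v = u + poly_LT \<sigma> g)) gs of
       Some g \<Rightarrow> (v - Poly_Mapping.single (poly_LT \<sigma> v - poly_LT \<sigma> g) 1 * g, r)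
     | None \<Rightarrow> (v - Poly_Mapping.single (poly_LT \<sigma> v) 1, r + Poly_Mapping.single (poly_LT \<sigma> v) 1))"

definition NR :: "'n pterm rel \<Rightarrow> 'n bpoly \<Rightarrow> 'n bpoly list \<Rightarrow> 'n bpoly" where
  "NR \<sigma> f gs = abs_bpoly (snd (the
     (while_option (\<lambda>(v, r). v \<noteq> 0) (div_step \<sigma> (map sqfree_rep gs)) (sqfree_rep f, 0))))"


section \<open>Formulas in 2-XNF\<close>

datatype 'n literal = Pos 'n | Neg 'n

text \<open>A lineral is the XOR of a list of literals, a clause the disjunction of a list of linerals,
  and a formula the conjunction of a list of clauses.\<close>

type_synonym 'n lineral = "'n literal list"
type_synonym 'n xnf = "'n lineral list list"

definition two_xnf :: "'n xnf \<Rightarrow> bool" where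
  "two_xnf F \<longleftrightarrow> (\<forall>C\<in>set F. length C \<le> 2)"

primrec literal_val :: "bit ^ 'n \<Rightarrow> 'n literal \<Rightarrow> bit" where
  "literal_val a (Pos i) = a $ i"
| "literal_val a (Neg i) = 1 + a $ i"

definition lineral_val :: "bit ^ 'n \<Rightarrow> 'n lineral \<Rightarrow> bit" where
  "lineral_val a l = sum_list (map (literal_val a) l)"

definition sat_set :: "'n xnf \<Rightarrow> (bit ^ 'n) set" where
  "sat_set F = {a. \<forall>C\<in>set F. \<exists>l\<in>set C. lineral_val a l = 1}"

definition formula_ideal :: "'n::finite xnf \<Rightarrow> 'n bpoly set" where
  "formula_ideal F = (THE I. ideal.subspace I \<and> zeros I = sat_set F)"


section \<open>Implication graph structures\<close>

type_synonym 'n edges = "('n bpoly \<times> 'n bpoly) set"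
type_synonym 'n igs = "'n bpoly set \<times> 'n bpoly set \<times> 'n edges"

definition is_igs :: "'n::finite xnf \<Rightarrow> 'n igs \<Rightarrow> bool" where
  "is_igs F = (\<lambda>(L, V, E).
     L \<subseteq> linear_bpolys \<and> V \<subseteq> linear_bpolys \<and> E \<subseteq> V \<times> V \<and>
     formula_ideal F =
       {p + q | p q. p \<in> ideal.span L \<and> q \<in> ideal.span {f * g | f g. (f + 1, g) \<in> E}} \<and>
     (\<forall>f g. (f + 1, g) \<in> E \<longrightarrow> (g + 1, f) \<in> E) \<and>
     (\<forall>f\<in>V. (f, f) \<notin> E))"

definition is_path :: "'n bpoly set \<Rightarrow> 'n edges \<Rightarrow> 'n bpoly list \<Rightarrow> bool" where
  "is_path V E p \<longleftrightarrow> p \<noteq> [] \<and> set p \<subseteq> V \<and> successively (\<lambda>f g. (f, g) \<in> E) p"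

definition connected_by_path :: "'n bpoly set \<Rightarrow> 'n edges \<Rightarrow> 'n bpoly \<Rightarrow> 'n bpoly \<Rightarrow> bool" where
  "connected_by_path V E f g \<longleftrightarrow> (\<exists>p. is_path V E p \<and> hd p = f \<and> last p = g)"

definition descendants :: "'n bpoly set \<Rightarrow> 'n edges \<Rightarrow> 'n bpoly \<Rightarrow> 'n bpoly set" where
  "descendants V E f = {f} \<union> {g \<in> V. connected_by_path V E f g}"

definition sccs :: "'n bpoly set \<Rightarrow> 'n edges \<Rightarrow> 'n bpoly set set" where
  "sccs V E = V // {(f, g). f \<in> V \<and> g \<in> V \<and> connected_by_path V E f g \<and> connected_by_path V E g f}"


section \<open>The procedures\<close>

text \<open>A basis of the span of \<open>L\<close> with pairwise distinct leading terms. It is enumerated as a tuple since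
  the division algorithm divides by a tuple.\<close>

definition LT_basis :: "'n pterm rel \<Rightarrow> 'n bpoly set \<Rightarrow> 'n bpoly list \<Rightarrow> bool" where
  "LT_basis \<sigma> L gs \<longleftrightarrow> distinct gs \<and> F2.independent (set gs) \<and> F2.span (set gs) = F2.span L \<and>
     inj_on (LT \<sigma>) (set gs)"

text \<open>The effect of the loop of GGCP over all edges. The loop divides by the fixed tuple \<open>gs\<close> while
  it appends to the new sets, so it is independent of the order of the edges.\<close>

definition ggcp_pass :: "'n pterm rel \<Rightarrow> 'n bpoly list \<Rightarrow> 'n edges \<Rightarrow> 'n igs" where
  "ggcp_pass \<sigma> gs E =
     (let R = {(NR \<sigma> f gs, NR \<sigma> g gs) | f g. (f, g) \<in> E};
          E' = {(f', g') \<in> R. f' \<notin> {0, 1} \<and> g' \<notin> {0, 1} \<and> f' \<noteq> g'}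
      in (set gs \<union> {g' | f' g'. (f', g') \<in> R \<and> f' = 0 \<and> g' \<noteq> 0}
                \<union> {f' + 1 | f' g'. (f', g') \<in> R \<and> g' = 1 \<and> f' \<noteq> 1},
          fst ` E' \<union> snd ` E',
          E'))"

text \<open>The possible values of the set of sums collected by crGGCP; \<open>c S\<close> is the element of \<open>S\<close> that is listed first.\<close>

definition scc_linerals :: "'n bpoly set \<Rightarrow> 'n edges \<Rightarrow> 'n bpoly set \<Rightarrow> bool" where
  "scc_linerals V E L_SCC \<longleftrightarrow>
     (\<exists>c. (\<forall>S\<in>sccs V E. c S \<in> S) \<and> L_SCC = {c S + f | S f. S \<in> sccs V E \<and> f \<in> S - {c S}})"

definition tFLS :: "'n bpoly set \<Rightarrow> 'n edges \<Rightarrow> 'n bpoly set" where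
  "tFLS V E = {f \<in> V. connected_by_path V E f (f + 1) \<or>
     (\<exists>g\<in>V. connected_by_path V E f g \<and> connected_by_path V E f (g + 1))}"

definition sources :: "'n bpoly set \<Rightarrow> 'n edges \<Rightarrow> 'n bpoly set" where
  "sources V E = {f \<in> V. \<forall>g. (g, f) \<notin> E}"

definition paths_from :: "'n bpoly set \<Rightarrow> 'n edges \<Rightarrow> 'n bpoly \<Rightarrow> nat" where
  "paths_from V E f = card {p. is_path V E p \<and> hd p = f}"

definition paths_to :: "'n bpoly set \<Rightarrow> 'n edges \<Rightarrow> 'n bpoly \<Rightarrow> nat" where
  "paths_to V E f = card {p. is_path V E p \<and> last p = f}"

inductive decision :: "'n bpoly set \<Rightarrow> 'n edges \<Rightarrow> 'n bpoly set \<Rightarrow> 'n bpoly set \<Rightarrow> bool"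
  for V E where
  MaxReach:
    "is_arg_max (paths_from V E) (\<lambda>h. h \<in> sources V E) f \<Longrightarrow>
     decision V E (descendants V E f) {f + 1}"
| MaxBottleneck:
    "is_arg_max (\<lambda>h. paths_to V E h + paths_from V E h) (\<lambda>h. h \<in> V) f \<Longrightarrow>
     decision V E (descendants V E f) (descendants V E (f + 1))"
| MaxPath:
    "is_arg_max length (is_path V E) p \<Longrightarrow>
     decision V E {hd p + f | f. f \<in> set p} {hd p + 1, last p}"

datatype 'n result = UNSAT | SAT "bit ^ 'n"

text \<open>
  The procedure SOLVER, which calls crGGCP, which calls GGCP, as a nondeterministic transition
  system: all bases, representatives, solutions and decisions (with the heuristic chosen anew
  each time) that the procedures allow are possible. The control points are
  \<^item> \<open>GGCP_Start G\<close>: GGCP is about to choose a basis; this is also where a call of crGGCP or SOLVER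
    on \<open>G\<close> starts;
  \<^item> \<open>GGCP_Done G\<close>: GGCP has returned \<open>G\<close> to crGGCP, which is about to compute the strongly
    connected components;
  \<^item> \<open>crGGCP_Done G\<close>: crGGCP has returned \<open>G\<close> to SOLVER, which is about to compute the trivial failed
    linerals;
  \<^item> \<open>No_Failed G\<close>: SOLVER has found no trivial failed lineral in \<open>G\<close>, and is about to test for
    unsatisfiability;
  \<^item> \<open>Return r\<close>: the current call of SOLVER has returned \<open>r\<close>.

  The second component of a configuration is the stack of the calls of SOLVER that are waiting
  for their first recursive call, innermost first; each is represented by the argument of its
  second recursive call. As the result of the latter is returned unchanged, it is a tail call and
  does not need a stack frame.
\<close>

datatype 'n control =
    GGCP_Start "'n igs"
  | GGCP_Done "'n igs"
  | crGGCP_Done "'n igs"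
  | No_Failed "'n igs"
  | Return "'n result"

type_synonym 'n config = "'n control \<times> 'n igs list"

inductive solver_step :: "'n::finite pterm rel \<Rightarrow> 'n config \<Rightarrow> 'n config \<Rightarrow> bool"
  for \<sigma> where
  ggcp_goto:
    "LT_basis \<sigma> L gs \<Longrightarrow> ggcp_pass \<sigma> gs E = (L', V', E') \<Longrightarrow> set gs \<noteq> L' \<Longrightarrow>
     solver_step \<sigma> (GGCP_Start (L, V, E), st) (GGCP_Start (L', V', E'), st)"
| ggcp_return:
    "LT_basis \<sigma> L gs \<Longrightarrow> ggcp_pass \<sigma> gs E = (L', V', E') \<Longrightarrow> set gs = L' \<Longrightarrow>
     solver_step \<sigma> (GGCP_Start (L, V, E), st) (GGCP_Done (L', V', E'), st)"
| crggcp_odd: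
    "odd (card (sccs V E)) \<Longrightarrow>
     solver_step \<sigma> (GGCP_Done (L, V, E), st) (crGGCP_Done (insert 1 (range bvar), {}, {}), st)"
| crggcp_goto:
    "even (card (sccs V E)) \<Longrightarrow> scc_linerals V E L_SCC \<Longrightarrow> L_SCC \<noteq> {} \<Longrightarrow>
     solver_step \<sigma> (GGCP_Done (L, V, E), st) (GGCP_Start (L \<union> L_SCC, V, E), st)"
| crggcp_return:
    "even (card (sccs V E)) \<Longrightarrow> scc_linerals V E {} \<Longrightarrow>
     solver_step \<sigma> (GGCP_Done (L, V, E), st) (crGGCP_Done (L, V, E), st)"
| solver_failed:
    "tFLS V E \<noteq> {} \<Longrightarrow>
     solver_step \<sigma> (crGGCP_Done (L, V, E), st) (GGCP_Start (L \<union> {f + 1 | f. f \<in> tFLS V E}, V, E), st)"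
| solver_no_failed:
    "tFLS V E = {} \<Longrightarrow>
     solver_step \<sigma> (crGGCP_Done (L, V, E), st) (No_Failed (L, V, E), st)"
| solver_unsat:
    "1 \<in> F2.span L \<Longrightarrow>
     solver_step \<sigma> (No_Failed (L, V, E), st) (Return UNSAT, st)"
| solver_sat:
    "1 \<notin> F2.span L \<Longrightarrow> E = {} \<Longrightarrow> a \<in> zeros L \<Longrightarrow>
     solver_step \<sigma> (No_Failed (L, V, E), st) (Return (SAT a), st)"
| solver_decide:
    "1 \<notin> F2.span L \<Longrightarrow> E \<noteq> {} \<Longrightarrow> decision V E L\<^sub>0 L\<^sub>1 \<Longrightarrow>
     solver_step \<sigma> (No_Failed (L, V, E), st) (GGCP_Start (L \<union> L\<^sub>0, V, E), (L \<union> L\<^sub>1, V, E) # st)"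
| solver_first_sat:
    "solver_step \<sigma> (Return (SAT a), G # st) (Return (SAT a), st)"
| solver_first_unsat:
    "solver_step \<sigma> (Return UNSAT, G # st) (GGCP_Start G, st)"

definition solver_reaches :: "'n::finite pterm rel \<Rightarrow> 'n igs \<Rightarrow> 'n config \<Rightarrow> bool" where
  "solver_reaches \<sigma> G c \<longleftrightarrow> (solver_step \<sigma>)\<^sup>*\<^sup>* (GGCP_Start G, []) c"

definition solver_returns :: "'n::finite pterm rel \<Rightarrow> 'n igs \<Rightarrow> 'n result \<Rightarrow> bool" where
  "solver_returns \<sigma> G r \<longleftrightarrow> solver_reaches \<sigma> G (Return r, [])"

text \<open>Termination: no run is infinite, and a run only ends by returning a result, i.e. no run gets
  stuck at an instruction that cannot be executed.\<close>

definition solver_terminates :: "'n::finite pterm rel \<Rightarrow> 'n igs \<Rightarrow> bool" where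
  "solver_terminates \<sigma> G \<longleftrightarrow>
     \<not> (\<exists>c. c 0 = (GGCP_Start G, []) \<and> (\<forall>k. solver_step \<sigma> (c k) (c (Suc k)))) \<and>
     (\<forall>c. solver_reaches \<sigma> G c \<longrightarrow> (\<exists>c'. solver_step \<sigma> c c') \<or> (\<exists>r. c = (Return r, [])))"

end

theory Submission
  imports Defs
begin

text \<open>
  An edge \<open>(f, g)\<close> says that \<open>g\<close> vanishes at every solution at which \<open>f\<close> vanishes. Each step of the
  procedures keeps the set of common zeros of \<open>L\<close> that respect all edges, except for a decision, which
  covers it by the sets of two new structures. Hence the union of these sets over the current call and the
  waiting calls stays inside the set of satisfying assignments and is empty only if the latter is.

  The normal remainders modulo \<open>L\<close> form a subspace that meets the span of \<open>L\<close> in \<open>0\<close> only, and after GGCP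
  all vertices lie in it and differ from \<open>0\<close> and \<open>1\<close>. So each later enlargement of \<open>L\<close> properly enlarges its
  span, which gives termination.
\<close>

text \<open>Two points shape the details. First, the constant 1 disturbs division. A linear term is
  divisible only by itself and by the term 1, so dividing linear polynomials by a basis without 1 is
  Gaussian elimination, and a remainder differs from its dividend by an element of the span. If 1
  lies in the span, it occurs in the basis and divides every term; that congruence may fail, but
  then all remainders are 0 and there are no solutions. Hence the case distinction on
  \<open>1 \<in> F2.span L\<close> wherever remainders are used. Second,
  \<open>formula_ideal\<close>, \<open>sqfree_rep\<close> and \<open>NR\<close> are defined by
  descriptions or a partial loop and say nothing until existence, uniqueness or termination is
  shown. For \<open>formula_ideal\<close> this is the Boolean Nullstellensatz: ideals correspond to
  sets of points. After that, only sets of zeros are used, not ideals. No claim may depend on the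
  choices made in a run, so the invariants speak of spans and zeros, and every transition must lower
  the weight.\<close>

declare add_bit_eq_xor [simp del] mult_bit_eq_and [simp del]

section \<open>Boolean polynomials as functions\<close>

text \<open>This makes the points \<open>bit ^ 'n\<close> a finite type, so that a product may range
  over all points outside a zero set.\<close>

instance bit :: finite
  by standard (rule finite_subset[of _ "{0, 1}"], auto)

lemma bit_add_self [simp]: "x + x = (0 :: bit)"
  by (cases x) (simp_all add: add_bit_eq_xor)

lemma bit_add_eq_0_iff: "x + y = 0 \<longleftrightarrow> x = (y :: bit)"
  by (cases x; cases y) (simp_all add: add_bit_eq_xor)

lemma bit_eq_iff_zero_iff: "x = y \<longleftrightarrow> (x = 0 \<longleftrightarrow> y = (0 :: bit))"
  by (cases x; cases y) simp_all

lemma f2poly_add_self [simp]: "p + p = (0 :: 'a \<Rightarrow>\<^sub>0 bit)"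
  by (rule poly_mapping_eqI) (simp only: lookup_add lookup_zero bit_add_self)

lemma f2poly_minus: "p - q = (p + q :: 'a \<Rightarrow>\<^sub>0 bit)"
  by (rule poly_mapping_eqI) (simp add: lookup_add lookup_minus)

lemma keys_f2poly_add:
  fixes p q :: "'a \<Rightarrow>\<^sub>0 bit"
  shows "t \<in> Poly_Mapping.keys (p + q) \<longleftrightarrow> (t \<in> Poly_Mapping.keys p) \<noteq> (t \<in> Poly_Mapping.keys q)"
  unfolding in_keys_iff lookup_add
  by (cases "Poly_Mapping.lookup p t"; cases "Poly_Mapping.lookup q t") simp_all

lemma f2poly_eqI:
  fixes p q :: "'a \<Rightarrow>\<^sub>0 bit"
  assumes "Poly_Mapping.keys p = Poly_Mapping.keys q"
  shows "p = q"
proof (rule poly_mapping_eqI)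
  fix k
  have "k \<in> Poly_Mapping.keys p \<longleftrightarrow> k \<in> Poly_Mapping.keys q"
    using assms by simp
  then show "Poly_Mapping.lookup p k = Poly_Mapping.lookup q k"
    unfolding in_keys_iff
    by (cases "Poly_Mapping.lookup p k"; cases "Poly_Mapping.lookup q k") simp_all
qed

lemma abs_bpoly_add: "abs_bpoly (p + q) = abs_bpoly p + abs_bpoly q"
  by (simp add: plus_bpoly.abs_eq)

lemma abs_bpoly_eq_iff: "abs_bpoly p = abs_bpoly q \<longleftrightarrow> p - q \<in> field_ideal"
  by (simp add: bpoly.abs_eq_iff)

lemma abs_bpoly_zero: "abs_bpoly 0 = 0"
  by (simp add: zero_bpoly_def)

lemma abs_bpoly_one: "abs_bpoly 1 = 1"
  by (simp add: one_bpoly_def)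

lemma bpoly_add_self [simp]: "f + f = (0 :: 'n bpoly)"
  by (induction f rule: bpoly.abs_induct) (simp only: abs_bpoly_zero f2poly_add_self flip: abs_bpoly_add)

lemma bpoly_add_add_self [simp]: "f + (f + g) = (g :: 'n bpoly)"
  by (simp flip: add.assoc)

lemma bpoly_uminus [simp]: "- f = (f :: 'n bpoly)"
  by (simp add: minus_unique)

lemma bpoly_minus [simp]: "f - g = f + (g :: 'n bpoly)"
  by (simp only: diff_conv_add_uminus bpoly_uminus)

lemma bpoly_add_eq_0_iff [simp]: "f + g = 0 \<longleftrightarrow> f = (g :: 'n bpoly)"
  by (metis bpoly_add_self bpoly_add_add_self add_0_right)

lemma bval_abs: "bval a (abs_bpoly p) = poly_val a p"
  by (rule bval.abs_eq)

lemma bval_add [simp]: "bval a (f + g) = bval a f + bval a g"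
  by transfer (rule poly_val_add)

lemma bval_mult [simp]: "bval a (f * g) = bval a f * bval a g"
  by transfer (rule poly_val_times)

lemma bval_zero [simp]: "bval a 0 = 0"
  by transfer simp

lemma bval_one [simp]: "bval a 1 = 1"
  by transfer (simp add: poly_val_single term_val_def flip: single_one)

lemma bval_prod: "bval a (prod f A) = (\<Prod>x\<in>A. bval a (f x))"
  by (induction A rule: infinite_finite_induct) simp_all

lemma bval_bvar [simp]: "bval a (bvar i) = a $ i"
proof transfer
  fix a :: "bit ^ 'b" and i :: 'b
  have "term_val a (Poly_Mapping.single i 1) = (\<Prod>j\<in>UNIV. if i = j then a $ j else 1)"
    unfolding term_val_def by (rule prod.cong) (auto simp: lookup_single when_def)
  then show "poly_val a (indet i) = a $ i"
    by (simp add: indet_def poly_val_single del: One_nat_def)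
qed

section \<open>Square-free representatives\<close>

definition sqfree :: "'n f2poly \<Rightarrow> bool" where
  "sqfree p \<longleftrightarrow> (\<forall>t\<in>Poly_Mapping.keys p. \<forall>i. Poly_Mapping.lookup t i \<le> 1)"

lemma sqfree_zero: "sqfree 0"
  by (simp add: sqfree_def)

lemma sqfree_add: "sqfree p \<Longrightarrow> sqfree q \<Longrightarrow> sqfree (p + q)"
  using Poly_Mapping.keys_add[of p q] by (auto simp: sqfree_def)

text \<open>Induction on the total degree: modulo \<open>indet i ^ 2 - indet i\<close>, an exponent
  of at least 2 can be lowered by one.\<close>

lemma sqfree_single_cong: "\<exists>q. sqfree q \<and> abs_bpoly (Poly_Mapping.single t 1) = abs_bpoly q"
  for t :: "'n::finite pterm"
proof (induction "\<Sum>i\<in>UNIV. Poly_Mapping.lookup t i" arbitrary: t rule: less_induct)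
  case less
  show ?case
  proof (cases "sqfree (Poly_Mapping.single t 1 :: 'n f2poly)")
    case True
    then show ?thesis by blast
  next
    case False
    then obtain i where i: "Poly_Mapping.lookup t i \<ge> 2"
      by (auto simp: sqfree_def not_le Suc_le_eq numeral_2_eq_2)
    define e :: "'n pterm" where "e = Poly_Mapping.single i 1"
    define s where "s = t - e - e"
    have t: "t = s + e + e"
      by (rule poly_mapping_eqI)
        (use i in \<open>auto simp: s_def e_def lookup_add lookup_minus lookup_single when_def\<close>)
    have "(\<Sum>j\<in>UNIV. Poly_Mapping.lookup (s + e) j) < (\<Sum>j\<in>UNIV. Poly_Mapping.lookup t j)"
      by (rule sum_strict_mono_ex1) (auto simp: t lookup_add e_def lookup_single when_def)
    then obtain q where q: "sqfree q" "abs_bpoly (Poly_Mapping.single (s + e) 1) = abs_bpoly q"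
      using less by blast
    have "Poly_Mapping.single t 1 - Poly_Mapping.single (s + e) 1
        = Poly_Mapping.single s 1 * (indet i ^ 2 - indet i :: 'n f2poly)"
      by (simp add: t e_def indet_def right_diff_distrib mult_single power2_eq_square add.assoc del: minus_bit_def)
    also have "\<dots> \<in> field_ideal"
      by (rule field_ideal_mult) (auto simp: field_ideal_def intro: ideal.span_base)
    finally show ?thesis
      using q by (metis abs_bpoly_eq_iff)
  qed
qed

lemma f2poly_decomp: "p = (\<Sum>t\<in>Poly_Mapping.keys p. Poly_Mapping.single t 1)"
  for p :: "'a \<Rightarrow>\<^sub>0 bit"
  by (rule poly_mapping_eqI) (simp add: lookup_sum lookup_single when_def in_keys_iff)

lemma sqfree_ex: "\<exists>p. sqfree p \<and> abs_bpoly p = f" for f :: "'n::finite bpoly"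
proof -
  obtain q where q: "f = abs_bpoly q" by (induction f rule: bpoly.abs_induct) blast
  have "\<exists>p. sqfree p \<and> abs_bpoly p = abs_bpoly (\<Sum>t\<in>A. Poly_Mapping.single t 1 :: 'n f2poly)"
    if "finite A" for A
    using that
  proof (induction A)
    case empty
    then show ?case using sqfree_zero by auto
  next
    case (insert t A)
    obtain p where p: "sqfree p" "abs_bpoly p = abs_bpoly (\<Sum>t\<in>A. Poly_Mapping.single t 1)"
      using insert.IH by blast
    obtain r :: "'n f2poly" where r: "sqfree r" "abs_bpoly (Poly_Mapping.single t 1) = abs_bpoly r"
      using sqfree_single_cong by blast
    have "abs_bpoly (r + p) = abs_bpoly (\<Sum>t\<in>insert t A. Poly_Mapping.single t 1)"
      using insert p r by (simp add: abs_bpoly_add)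
    then show ?case using sqfree_add[OF r(1) p(1)] by blast
  qed
  from this[OF finite_keys] have *: "\<exists>p. sqfree p \<and>
      abs_bpoly p = abs_bpoly (\<Sum>t\<in>Poly_Mapping.keys q. Poly_Mapping.single t 1 :: 'n f2poly)" .
  have "abs_bpoly q = abs_bpoly (\<Sum>t\<in>Poly_Mapping.keys q. Poly_Mapping.single t 1)"
    by (rule arg_cong[OF f2poly_decomp])
  with * show ?thesis unfolding q by (simp only:)
qed

text \<open>A term of \<open>p\<close> with the fewest indeterminates is isolated by evaluating at
  the characteristic vector of its support: every other term contains an indeterminate outside that
  support, so exactly one summand survives.\<close>

lemma sqfree_eq_0:
  fixes p :: "'n::finite f2poly"
  assumes "sqfree p" and zero: "\<And>a. poly_val a p = 0"
  shows "p = 0"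
proof (rule ccontr)
  assume "p \<noteq> 0"
  then have "\<exists>t. t \<in> Poly_Mapping.keys p"
    by (metis ex_in_conv keys_eq_empty keys_zero f2poly_eqI)
  then obtain t where t: "t \<in> Poly_Mapping.keys p"
    and min: "\<And>s. s \<in> Poly_Mapping.keys p \<Longrightarrow> card (Poly_Mapping.keys t) \<le> card (Poly_Mapping.keys s)"
    using ex_has_least_nat[of "\<lambda>t. t \<in> Poly_Mapping.keys p" _ "\<lambda>t. card (Poly_Mapping.keys t)"] by blast
  define a :: "bit ^ 'n" where "a = (\<chi> i. if i \<in> Poly_Mapping.keys t then 1 else 0)"
  have tv: "term_val a s = (if s = t then 1 else 0)" if s: "s \<in> Poly_Mapping.keys p" for s
  proof (cases "Poly_Mapping.keys s \<subseteq> Poly_Mapping.keys t")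
    case True
    then have eq: "Poly_Mapping.keys s = Poly_Mapping.keys t"
      using min[OF s] by (simp add: card_subset_eq[OF finite_keys] card_mono le_antisym)
    have "Poly_Mapping.lookup s i = Poly_Mapping.lookup t i" for i
    proof -
      have "Poly_Mapping.lookup s i \<le> 1" "Poly_Mapping.lookup t i \<le> 1"
        using \<open>sqfree p\<close> s t by (auto simp: sqfree_def)
      moreover have "Poly_Mapping.lookup s i = 0 \<longleftrightarrow> Poly_Mapping.lookup t i = 0"
        using eq by (metis in_keys_iff)
      ultimately show ?thesis by linarith
    qed
    then have "s = t" by (rule poly_mapping_eqI)
    moreover have "term_val a t = 1"
      unfolding term_val_def
      by (rule prod.neutral) (auto simp: a_def in_keys_iff)
    ultimately show ?thesis by simp
  next
    case False
    then obtain i where "i \<in> Poly_Mapping.keys s" "i \<notin> Poly_Mapping.keys t" by blast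
    then have "(a $ i) ^ Poly_Mapping.lookup s i = 0" by (simp add: a_def in_keys_iff)
    then have "term_val a s = 0"
      unfolding term_val_def by (intro prod_zero) auto
    moreover have "s \<noteq> t" using False by auto
    ultimately show ?thesis by simp
  qed
  have "poly_val a p = (\<Sum>s\<in>Poly_Mapping.keys p. if s = t then 1 else 0)"
    unfolding poly_val_def by (rule sum.cong) (auto simp: tv in_keys_iff)
  also have "\<dots> = 1" using t by simp
  finally show False using zero[of a] by simp
qed

lemma sqfree_unique:
  assumes "sqfree p" "sqfree q" "abs_bpoly p = abs_bpoly q"
  shows "p = (q :: 'n::finite f2poly)"
proof -
  have "p + q = 0"
  proof (rule sqfree_eq_0[OF sqfree_add[OF assms(1,2)]])
    fix a
    from assms(3) have "poly_val a p = poly_val a q" by (metis bval_abs)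
    then show "poly_val a (p + q) = 0" by (simp add: poly_val_add)
  qed
  moreover have "p = (p + q) + q" by (simp only: add.assoc f2poly_add_self add_0_right)
  ultimately show ?thesis by simp
qed

text \<open>Existence by lowering exponents and uniqueness by evaluation justify the definite
  description in \<open>sqfree_rep\<close>.\<close>

lemma sqfree_rep: "sqfree (sqfree_rep f) \<and> abs_bpoly (sqfree_rep f) = f"
  for f :: "'n::finite bpoly"
proof -
  have "\<exists>!p. abs_bpoly p = f \<and> sqfree p"
    using sqfree_ex[of f] sqfree_unique by blast
  from theI'[OF this] show ?thesis
    unfolding sqfree_rep_def sqfree_def by blast
qed

lemma abs_sqfree_rep [simp]: "abs_bpoly (sqfree_rep f) = (f :: 'n::finite bpoly)"
  using sqfree_rep by blast

lemma sqfree_rep_abs: "sqfree p \<Longrightarrow> sqfree_rep (abs_bpoly p) = (p :: 'n::finite f2poly)"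
  by (rule sqfree_unique) (simp_all add: sqfree_rep)

lemma sqfree_rep_add: "sqfree_rep (f + g) = sqfree_rep f + sqfree_rep (g :: 'n::finite bpoly)"
  by (rule sqfree_unique) (simp_all add: sqfree_rep sqfree_add abs_bpoly_add)

lemma bpoly_eqI:
  fixes f g :: "'n::finite bpoly"
  assumes "\<And>a. bval a f = bval a g"
  shows "f = g"
proof -
  have "sqfree_rep (f + g) = 0"
    by (rule sqfree_eq_0) (simp_all add: sqfree_rep assms flip: bval_abs)
  then have "f + g = 0" by (metis abs_sqfree_rep abs_bpoly_zero)
  then show ?thesis by simp
qed

section \<open>Ideals and their zeros\<close>

lemma zeros_ideal_span: "zeros (ideal.span S) = zeros S"
proof -
  have "ideal.span S \<subseteq> {f. bval a f = 0}" if "a \<in> zeros S" for a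
    by (rule ideal.span_minimal) (use that in \<open>auto simp: ideal.subspace_def zeros_def\<close>)
  then show ?thesis
    using ideal.span_superset[of S] by (fastforce simp: zeros_def)
qed

text \<open>Lagrange interpolation: the factor for coordinate \<open>i\<close> is 1 where that
  coordinate agrees with \<open>a\<close> and 0 elsewhere. The conditional in it is
  \<open>a $ i\<close> read as a constant of the ring.\<close>

lemma exists_indicator:
  fixes a :: "bit ^ 'n::finite"
  shows "\<exists>f. \<forall>b. bval b f = (if b = a then 1 else 0)"
proof (intro exI allI)
  fix b :: "bit ^ 'n"
  have *: "b $ i + a $ i + 1 = (if b $ i = a $ i then 1 else 0)" for i
    by (cases "b $ i"; cases "a $ i") (simp_all add: add_bit_eq_xor)
  have "bval b (\<Prod>i\<in>UNIV. bvar i + (if a $ i = 0 then 0 else 1) + 1)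
    = (\<Prod>i\<in>UNIV. b $ i + a $ i + 1)"
    by (simp only: bval_prod) (rule prod.cong, auto)
  also have "\<dots> = (if b = a then 1 else 0)"
  proof (cases "b = a")
    case False
    then obtain i where "b $ i \<noteq> a $ i" by (auto simp: vec_eq_iff)
    then have "(\<Prod>i\<in>UNIV. b $ i + a $ i + 1) = 0"
      by (intro prod_zero bexI[of _ i]) (auto simp: *)
    then show ?thesis using False by simp
  next
    case True
    then show ?thesis by (simp only: *) simp
  qed
  finally show "bval b (\<Prod>i\<in>UNIV. bvar i + (if a $ i = 0 then 0 else 1) + 1) = (if b = a then 1 else 0)" .
qed

text \<open>The product constructs a generator of the ideal: the characteristic function of the
  complement of its zeros.\<close>

lemma in_ideal_if_vanishes_on_zeros:
  fixes f :: "'n::finite bpoly"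
  assumes I: "ideal.subspace I" and f: "\<And>a. a \<in> zeros I \<Longrightarrow> bval a f = 0"
  shows "f \<in> I"
proof -
  define p where "p a = (SOME g. g \<in> I \<and> bval a g = 1)" for a
  have p: "p a \<in> I \<and> bval a (p a) = 1" if "a \<in> - zeros I" for a
    unfolding p_def by (rule someI_ex) (use that in \<open>auto simp: zeros_def\<close>)
  define A where "A = - zeros I"
  have "finite A" by simp
  have "(\<Prod>a\<in>B. 1 + p a) + 1 \<in> I" if "finite B" "B \<subseteq> A" for B
    using that
  proof (induction B)
    case empty
    then show ?case using I by (simp add: ideal.subspace_0)
  next
    case (insert a B)
    have "(\<Prod>a\<in>insert a B. 1 + p a) + 1
        = ((\<Prod>a\<in>B. 1 + p a) + 1) + (\<Prod>a\<in>B. 1 + p a) * p a"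
      using insert by (simp add: algebra_simps)
    moreover have "(\<Prod>a\<in>B. 1 + p a) * p a \<in> I"
      using insert.prems p[of a] by (intro ideal.subspace_scale[OF I]) (simp add: A_def)
    ultimately show ?case
      using insert by (simp only:) (simp add: ideal.subspace_add[OF I])
  qed
  from this[of A] have g: "(\<Prod>a\<in>A. 1 + p a) + 1 \<in> I" (is "?g \<in> I")
    using \<open>finite A\<close> by simp
  have fg: "f = f * ?g"
  proof (rule bpoly_eqI)
    fix a
    show "bval a f = bval a (f * ?g)"
    proof (cases "a \<in> zeros I")
      case False
      then have "(\<Prod>b\<in>A. 1 + bval a (p b)) = 0"
        using p[of a] by (intro prod_zero bexI[of _ a]) (auto simp: A_def)
      then show ?thesis by (simp add: bval_prod)
    qed (simp add: f)
  qed
  from ideal.subspace_scale[OF I g, of f] show ?thesis by (simp only: fg[symmetric])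
qed

text \<open>The definite description is met by the vanishing ideal \<open>J\<close> of
  \<open>sat_set F\<close>: indicator functions keep its zeros from being too many, and the
  Nullstellensatz above makes any other candidate equal to it.\<close>

lemma zeros_formula_ideal: "zeros (formula_ideal F) = sat_set (F :: 'n::finite xnf)"
proof -
  define J where "J = {f :: 'n bpoly. \<forall>a\<in>sat_set F. bval a f = 0}"
  have J: "ideal.subspace J" by (auto simp: ideal.subspace_def J_def)
  have zJ: "zeros J = sat_set F"
  proof
    show "zeros J \<subseteq> sat_set F"
    proof
      fix a assume a: "a \<in> zeros J"
      obtain f where f: "\<forall>b. bval b f = (if b = a then 1 else 0)"
        using exists_indicator by blast
      show "a \<in> sat_set F"
      proof (rule ccontr)
        assume "a \<notin> sat_set F"
        then have "f \<in> J" using f by (auto simp: J_def)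
        then have "bval a f = 0" using a by (auto simp: zeros_def)
        then show False using f by simp
      qed
    qed
  qed (auto simp: zeros_def J_def)
  have "I = J" if "ideal.subspace I" "zeros I = sat_set F" for I
  proof
    show "I \<subseteq> J" using that by (auto simp: J_def zeros_def)
    show "J \<subseteq> I" using in_ideal_if_vanishes_on_zeros[OF that(1)] that(2) by (auto simp: J_def)
  qed
  with J zJ have "\<exists>!I. ideal.subspace I \<and> zeros I = sat_set F" by blast
  from theI'[OF this] show ?thesis by (simp add: formula_ideal_def)
qed

section \<open>Supports and linear Boolean polynomials\<close>

text \<open>With coefficients in the two-element field the support determines the polynomial, and
  addition is symmetric difference; cancellation arguments become arguments on finite sets of
  terms.\<close>

definition supp :: "'n bpoly \<Rightarrow> 'n pterm set" where
  "supp f = Poly_Mapping.keys (sqfree_rep f)"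

lemma supp_abs: "sqfree p \<Longrightarrow> supp (abs_bpoly p) = Poly_Mapping.keys (p :: 'n::finite f2poly)"
  by (simp add: supp_def sqfree_rep_abs)

lemma in_supp_add: "t \<in> supp (f + g) \<longleftrightarrow> (t \<in> supp f) \<noteq> (t \<in> supp (g :: 'n::finite bpoly))"
  unfolding supp_def sqfree_rep_add by (rule keys_f2poly_add)

lemma supp_inject: "supp f = supp g \<Longrightarrow> f = (g :: 'n::finite bpoly)"
  unfolding supp_def by (metis f2poly_eqI abs_sqfree_rep)

lemma supp_zero [simp]: "supp (0 :: 'n::finite bpoly) = {}"
  using supp_abs[OF sqfree_zero] by (simp add: abs_bpoly_zero)

lemma supp_eq_empty_iff [simp]: "supp f = {} \<longleftrightarrow> f = (0 :: 'n::finite bpoly)"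
  using supp_inject[of f 0] by auto

lemma supp_one [simp]: "supp (1 :: 'n::finite bpoly) = {0}"
  using supp_abs[of 1] by (simp add: abs_bpoly_one sqfree_def)

definition lin_terms :: "'n pterm set" where
  "lin_terms = insert 0 (range (\<lambda>i. Poly_Mapping.single i 1))"

lemma finite_lin_terms [simp]: "finite (lin_terms :: 'n::finite pterm set)"
  by (simp add: lin_terms_def)

lemma zero_in_lin_terms [simp]: "0 \<in> lin_terms"
  by (simp add: lin_terms_def)

lemma sqfree_lin: "Poly_Mapping.keys p \<subseteq> lin_terms \<Longrightarrow> sqfree p"
  by (fastforce simp: sqfree_def lin_terms_def lookup_single when_def)

lemma abs_bpoly_single_var: "abs_bpoly (Poly_Mapping.single (Poly_Mapping.single i 1) 1) = bvar i"
  by (simp add: bvar_def indet_def)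

lemma supp_bvar [simp]: "supp (bvar i :: 'n::finite bpoly) = {Poly_Mapping.single i 1}"
proof -
  have "sqfree (Poly_Mapping.single (Poly_Mapping.single i 1) 1 :: 'n f2poly)"
    by (rule sqfree_lin) (auto simp: lin_terms_def)
  from supp_abs[OF this] show ?thesis
    unfolding abs_bpoly_single_var by simp
qed

lemma bscale_eq: "bscale c f = (if c = 0 then 0 else f)"
  using F2.scale_zero_left[of f] F2.scale_one[of f] by (cases c) auto

lemma F2_subspace_iff: "F2.subspace S \<longleftrightarrow> 0 \<in> S \<and> (\<forall>f\<in>S. \<forall>g\<in>S. f + g \<in> S)"
  by (auto simp: F2.subspace_def bscale_eq)

lemma linear_bpolys_subspace: "F2.subspace linear_bpolys"
  by (simp add: linear_bpolys_def F2.subspace_span)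

lemma linear_bpolys_add: "f \<in> linear_bpolys \<Longrightarrow> g \<in> linear_bpolys \<Longrightarrow> f + g \<in> linear_bpolys"
  using linear_bpolys_subspace F2.subspace_add by blast

lemma zero_linear [simp]: "0 \<in> linear_bpolys"
  using linear_bpolys_subspace F2.subspace_0 by blast

lemma one_linear [simp]: "1 \<in> linear_bpolys"
  by (simp add: linear_bpolys_def F2.span_base)

lemma bvar_linear [simp]: "bvar i \<in> linear_bpolys"
  by (simp add: linear_bpolys_def F2.span_base)

lemma span_linear: "L \<subseteq> linear_bpolys \<Longrightarrow> F2.span L \<subseteq> linear_bpolys"
  by (rule F2.span_minimal[OF _ linear_bpolys_subspace])

lemma linear_abs:
  fixes p :: "'n::finite f2poly"
  assumes "Poly_Mapping.keys p \<subseteq> lin_terms"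
  shows "abs_bpoly p \<in> linear_bpolys"
proof -
  have "abs_bpoly (\<Sum>t\<in>A. Poly_Mapping.single t 1 :: 'n f2poly) \<in> linear_bpolys"
    if "finite A" "A \<subseteq> lin_terms" for A
    using that
  proof (induction A)
    case empty
    then show ?case by (simp add: abs_bpoly_zero)
  next
    case (insert t A)
    have "abs_bpoly (Poly_Mapping.single t 1 :: 'n f2poly) \<in> linear_bpolys"
    proof (cases "t = 0")
      case True
      then show ?thesis by (simp add: abs_bpoly_one)
    next
      case False
      with insert.prems obtain i where "t = Poly_Mapping.single i 1"
        by (auto simp: lin_terms_def)
      then show ?thesis by (simp only: abs_bpoly_single_var bvar_linear)
    qed
    then show ?case using insert by (simp add: abs_bpoly_add linear_bpolys_add)
  qed
  from this[OF finite_keys assms] show ?thesis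
    by (simp only: f2poly_decomp[symmetric])
qed

lemma linear_iff_supp: "f \<in> linear_bpolys \<longleftrightarrow> supp (f :: 'n::finite bpoly) \<subseteq> lin_terms"
proof
  have "F2.subspace {f :: 'n bpoly. supp f \<subseteq> lin_terms}"
    by (auto simp: F2_subspace_iff in_supp_add)
  then have "linear_bpolys \<subseteq> {f :: 'n bpoly. supp f \<subseteq> lin_terms}"
    unfolding linear_bpolys_def by (intro F2.span_minimal) (auto simp: lin_terms_def)
  then show "supp f \<subseteq> lin_terms" if "f \<in> linear_bpolys" using that by blast
next
  assume "supp f \<subseteq> lin_terms"
  then show "f \<in> linear_bpolys" using linear_abs[of "sqfree_rep f"] by (simp add: supp_def)
qed

text \<open>Termination of the whole procedure rests on this: \<open>corank\<close> counts inside
  this set.\<close>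

lemma finite_linear_bpolys [simp]: "finite (linear_bpolys :: 'n::finite bpoly set)"
proof (rule inj_on_finite)
  show "inj_on supp (linear_bpolys :: 'n bpoly set)" by (rule inj_onI) (rule supp_inject)
  show "supp ` (linear_bpolys :: 'n bpoly set) \<subseteq> Pow lin_terms" by (auto simp: linear_iff_supp)
qed simp

lemma F2_span_finite:
  assumes "finite B" "h \<in> F2.span B"
  obtains A where "A \<subseteq> B" "h = \<Sum>A"
proof -
  obtain u where u: "h = (\<Sum>v\<in>B. bscale (u v) v)"
    using assms by (auto simp: F2.span_finite)
  have "h = (\<Sum>v\<in>{v\<in>B. u v \<noteq> 0}. v)"
    unfolding u bscale_eq by (rule sum.mono_neutral_cong_right) (use assms in auto)
  then show ?thesis using that[of "{v\<in>B. u v \<noteq> 0}"] by auto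
qed

section \<open>Leading terms and normal remainders\<close>

locale ordered_terms =
  fixes \<sigma> :: "'n::finite pterm rel"
  assumes term_ordering: "term_ordering \<sigma>"
begin

lemma le_refl: "(t, t) \<in> \<sigma>"
  and le_trans: "(s, t) \<in> \<sigma> \<Longrightarrow> (t, u) \<in> \<sigma> \<Longrightarrow> (s, u) \<in> \<sigma>"
  and le_antisym: "(s, t) \<in> \<sigma> \<Longrightarrow> (t, s) \<in> \<sigma> \<Longrightarrow> s = t"
  and le_total: "(s, t) \<in> \<sigma> \<or> (t, s) \<in> \<sigma>"
  and zero_le: "(0, t) \<in> \<sigma>"
proof -
  have lin: "linear_order \<sigma>" "\<forall>t. (0, t) \<in> \<sigma>"
    using term_ordering by (simp_all add: term_ordering_def)
  then have refl: "refl \<sigma>" and "trans \<sigma>" "antisym \<sigma>" "total \<sigma>"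
    by (simp_all add: linear_order_on_def partial_order_on_def preorder_on_def)
  show "(t, t) \<in> \<sigma>" using refl by (auto simp: refl_on_def)
  show "(s, t) \<in> \<sigma> \<Longrightarrow> (t, u) \<in> \<sigma> \<Longrightarrow> (s, u) \<in> \<sigma>" using \<open>trans \<sigma>\<close> by (rule transD)
  show "(s, t) \<in> \<sigma> \<Longrightarrow> (t, s) \<in> \<sigma> \<Longrightarrow> s = t" using \<open>antisym \<sigma>\<close> by (rule antisymD)
  show "(s, t) \<in> \<sigma> \<or> (t, s) \<in> \<sigma>"
    using \<open>total \<sigma>\<close> refl by (cases "s = t") (auto simp: total_on_def refl_on_def)
  show "(0, t) \<in> \<sigma>" using lin by blast
qed

lemma exists_max:
  assumes "finite A" "A \<noteq> {}"
  shows "\<exists>t\<in>A. \<forall>s\<in>A. (s, t) \<in> \<sigma>"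
  using assms
proof (induction rule: finite_ne_induct)
  case (singleton t)
  then show ?case using le_refl by auto
next
  case (insert u A)
  then obtain t where t: "t \<in> A" "\<forall>s\<in>A. (s, t) \<in> \<sigma>" by blast
  show ?case
  proof (cases "(u, t) \<in> \<sigma>")
    case False
    then have "(t, u) \<in> \<sigma>" using le_total by blast
    then show ?thesis using t le_trans le_refl by (intro bexI[of _ u]) auto
  qed (use t in auto)
qed

lemma poly_LT_eqI:
  assumes "t \<in> Poly_Mapping.keys p" "\<And>s. s \<in> Poly_Mapping.keys p \<Longrightarrow> (s, t) \<in> \<sigma>"
  shows "poly_LT \<sigma> p = t"
  unfolding poly_LT_def by (rule the_equality) (use assms le_antisym in blast)+

lemma poly_LT:
  assumes "p \<noteq> 0"
  shows poly_LT_in_keys: "poly_LT \<sigma> p \<in> Poly_Mapping.keys p"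
    and poly_LT_max: "s \<in> Poly_Mapping.keys p \<Longrightarrow> (s, poly_LT \<sigma> p) \<in> \<sigma>"
proof -
  have "Poly_Mapping.keys p \<noteq> {}" using assms by (metis f2poly_eqI keys_zero)
  then obtain t where "t \<in> Poly_Mapping.keys p" "\<forall>s\<in>Poly_Mapping.keys p. (s, t) \<in> \<sigma>"
    using exists_max[of "Poly_Mapping.keys p"] by auto
  moreover from this have "poly_LT \<sigma> p = t" by (blast intro: poly_LT_eqI)
  ultimately show "poly_LT \<sigma> p \<in> Poly_Mapping.keys p"
    "s \<in> Poly_Mapping.keys p \<Longrightarrow> (s, poly_LT \<sigma> p) \<in> \<sigma>" by auto
qed

lemma sqfree_rep_eq_0: "sqfree_rep f = 0 \<longleftrightarrow> f = (0 :: 'n bpoly)"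
  by (metis abs_sqfree_rep abs_bpoly_zero sqfree_rep_abs sqfree_zero)

lemma LT_eqI: "t \<in> supp f \<Longrightarrow> (\<And>s. s \<in> supp f \<Longrightarrow> (s, t) \<in> \<sigma>) \<Longrightarrow> LT \<sigma> f = t"
  unfolding LT_def supp_def by (rule poly_LT_eqI)

lemma LT_in_supp: "f \<noteq> 0 \<Longrightarrow> LT \<sigma> f \<in> supp f"
  unfolding LT_def supp_def by (rule poly_LT_in_keys) (simp add: sqfree_rep_eq_0)

lemma LT_max: "s \<in> supp f \<Longrightarrow> (s, LT \<sigma> f) \<in> \<sigma>"
  unfolding LT_def supp_def by (rule poly_LT_max) auto

lemma LT_one [simp]: "LT \<sigma> (1 :: 'n bpoly) = 0"
  by (rule LT_eqI) (auto simp: le_refl)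

lemma LT_eq_0_imp: "f \<noteq> 0 \<Longrightarrow> LT \<sigma> f = 0 \<Longrightarrow> f = 1"
proof (rule supp_inject)
  assume f: "f \<noteq> 0" "LT \<sigma> f = 0"
  have "s = 0" if "s \<in> supp f" for s
    using LT_max[OF that] zero_le le_antisym f(2) by simp
  then show "supp f = supp 1" using LT_in_supp[OF f(1)] f(2) by auto
qed

lemma LT_add_less:
  assumes "f \<noteq> 0" "(LT \<sigma> g, LT \<sigma> f) \<in> \<sigma>" "LT \<sigma> f \<noteq> LT \<sigma> g"
  shows "f + g \<noteq> 0 \<and> LT \<sigma> (f + g) = LT \<sigma> f"
proof -
  have "LT \<sigma> f \<notin> supp g"
    using LT_max[of "LT \<sigma> f" g] le_antisym assms by metis
  then have *: "LT \<sigma> f \<in> supp (f + g)"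
    using LT_in_supp[OF assms(1)] by (simp add: in_supp_add)
  moreover have "LT \<sigma> (f + g) = LT \<sigma> f"
  proof (rule LT_eqI[OF *])
    fix s assume "s \<in> supp (f + g)"
    then have "s \<in> supp f \<or> s \<in> supp g" by (auto simp: in_supp_add)
    then show "(s, LT \<sigma> f) \<in> \<sigma>"
      using LT_max le_trans assms(2) by blast
  qed
  ultimately show ?thesis by auto
qed

text \<open>Pairwise distinct leading terms cannot cancel, so the largest of them survives in the
  sum.\<close>

lemma LT_sum:
  assumes "finite A" "A \<noteq> {}" "0 \<notin> A" "inj_on (LT \<sigma>) A"
  shows "\<Sum>A \<noteq> 0 \<and> LT \<sigma> (\<Sum>A) \<in> LT \<sigma> ` A"
  using assms
proof (induction rule: finite_ne_induct)
  case (singleton f)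
  then show ?case by auto
next
  case (insert f A)
  then have IH: "\<Sum>A \<noteq> 0" "LT \<sigma> (\<Sum>A) \<in> LT \<sigma> ` A" and f: "f \<noteq> 0" by (auto simp: inj_on_insert)
  have ne: "LT \<sigma> f \<noteq> LT \<sigma> (\<Sum>A)"
    using insert.prems(2) insert.hyps(3) IH(2) by (auto simp: inj_on_def)
  have "f + \<Sum>A \<noteq> 0 \<and> LT \<sigma> (f + \<Sum>A) \<in> {LT \<sigma> f, LT \<sigma> (\<Sum>A)}"
  proof (cases "(LT \<sigma> (\<Sum>A), LT \<sigma> f) \<in> \<sigma>")
    case True
    then show ?thesis using LT_add_less[OF f True ne] by simp
  next
    case False
    then have "(LT \<sigma> f, LT \<sigma> (\<Sum>A)) \<in> \<sigma>" using le_total by blast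
    then show ?thesis using LT_add_less[OF IH(1) _ ne[symmetric]] by (simp add: add.commute)
  qed
  then show ?case using insert.hyps IH(2) by auto
qed

text \<open>The analogue of the Groebner basis property, for a span instead of an ideal.\<close>

lemma LT_span:
  assumes "finite B" "0 \<notin> B" "inj_on (LT \<sigma>) B" "h \<in> F2.span B" "h \<noteq> 0"
  shows "LT \<sigma> h \<in> LT \<sigma> ` B"
proof -
  obtain A where A: "A \<subseteq> B" "h = \<Sum>A" using F2_span_finite[OF assms(1,4)] .
  then have "A \<noteq> {}" using assms(5) by auto
  moreover have "finite A" "0 \<notin> A" "inj_on (LT \<sigma>) A"
    using A assms(1-3) by (auto intro: finite_subset inj_on_subset)
  ultimately show ?thesis using LT_sum[of A] A by auto
qed

lemma independent_distinct_LT: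
  assumes "finite B" "0 \<notin> B" "inj_on (LT \<sigma>) B"
  shows "F2.independent B"
  using assms
proof (induction B)
  case (insert f B)
  have "f \<notin> F2.span B"
  proof
    assume "f \<in> F2.span B"
    then have "LT \<sigma> f \<in> LT \<sigma> ` B" using insert by (intro LT_span) auto
    then show False using insert.prems(2) insert.hyps(2) by (auto simp: inj_on_def)
  qed
  then show ?case using insert by (intro F2.independent_insertI) auto
qed (simp add: F2.independent_empty)

text \<open>Measure for elimination: if the largest term \<open>t\<close> is traded for smaller
  ones, \<open>t\<close> itself is no longer counted. It serves both the construction of a basis and
  the division loop.\<close>

definition rk :: "'n pterm set \<Rightarrow> nat" where
  "rk A = card {s \<in> lin_terms. \<exists>t\<in>A. (s, t) \<in> \<sigma>}"

lemma rk_less: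
  assumes "t \<in> A" "t \<in> lin_terms" "\<And>s. s \<in> B \<Longrightarrow> (s, t) \<in> \<sigma> \<and> s \<noteq> t"
  shows "rk B < rk A"
  unfolding rk_def
proof (rule psubset_card_mono)
  show "{s \<in> lin_terms. \<exists>t\<in>B. (s, t) \<in> \<sigma>} \<subset> {s \<in> lin_terms. \<exists>t\<in>A. (s, t) \<in> \<sigma>}"
  proof (rule psubsetI)
    show "{s \<in> lin_terms. \<exists>t\<in>B. (s, t) \<in> \<sigma>} \<subseteq> {s \<in> lin_terms. \<exists>t\<in>A. (s, t) \<in> \<sigma>}"
      using assms le_trans by blast
    have "t \<notin> {s \<in> lin_terms. \<exists>t\<in>B. (s, t) \<in> \<sigma>}"
      using assms(3) le_antisym by blast
    moreover have "t \<in> {s \<in> lin_terms. \<exists>t\<in>A. (s, t) \<in> \<sigma>}"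
      using assms(1,2) le_refl by blast
    ultimately show "{s \<in> lin_terms. \<exists>t\<in>B. (s, t) \<in> \<sigma>} \<noteq> {s \<in> lin_terms. \<exists>t\<in>A. (s, t) \<in> \<sigma>}" by blast
  qed
qed simp

text \<open>Needed to show that GGCP never gets stuck. For each leading term that occurs in the
  span, one element with that leading term is chosen; subtracting chosen elements reduces any
  element of the span to 0.\<close>

lemma LT_basis_exists:
  fixes L :: "'n bpoly set"
  assumes "L \<subseteq> linear_bpolys"
  shows "\<exists>gs. LT_basis \<sigma> L gs"
proof -
  define U where "U = F2.span L"
  have U: "U \<subseteq> linear_bpolys" using span_linear[OF assms] by (simp add: U_def)
  have addU: "f + g \<in> U" if "f \<in> U" "g \<in> U" for f g
    using that by (simp add: U_def F2.span_add)
  define T where "T = LT \<sigma> ` (U - {0})"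
  define b where "b = inv_into (U - {0}) (LT \<sigma>)"
  have b: "b t \<in> U - {0}" "LT \<sigma> (b t) = t" if "t \<in> T" for t
    using that unfolding b_def T_def by (rule inv_into_into, rule f_inv_into_f)
  define B where "B = b ` T"
  have "B \<subseteq> U - {0}" using b(1) by (auto simp: B_def)
  have inj: "inj_on (LT \<sigma>) B" unfolding B_def by (rule inj_onI) (use b(2) in auto)
  have fin: "finite B"
    using \<open>B \<subseteq> U - {0}\<close> U finite_linear_bpolys by (meson Diff_subset finite_subset)
  have "f \<in> F2.span B" if "f \<in> U" for f
    using that
  proof (induction "rk (supp f)" arbitrary: f rule: less_induct)
    case less
    show ?case
    proof (cases "f = 0")
      case False
      define t where "t = LT \<sigma> f"
      have t: "t \<in> T" using False less.prems by (simp add: t_def T_def)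
      have f_t: "t \<in> supp f" using LT_in_supp[OF False] by (simp add: t_def)
      \<comment> \<open>Both summands have \<open>t\<close> as their largest term, so it
        cancels.\<close>
      have "rk (supp (f + b t)) < rk (supp f)"
      proof (rule rk_less[OF f_t])
        show "t \<in> lin_terms" using f_t less.prems U linear_iff_supp[of f] by blast
        fix s assume s: "s \<in> supp (f + b t)"
        have "t \<in> supp (b t)" using LT_in_supp[of "b t"] b[OF t] by auto
        then have "s \<noteq> t" using s f_t by (auto simp: in_supp_add)
        moreover have "(s, t) \<in> \<sigma>"
          using s LT_max[of s f] LT_max[of s "b t"] b(2)[OF t] by (auto simp: in_supp_add t_def)
        ultimately show "(s, t) \<in> \<sigma> \<and> s \<noteq> t" by blast
      qed
      then have "f + b t \<in> F2.span B"
        using less.hyps addU less.prems b(1)[OF t] by blast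
      moreover have "b t \<in> F2.span B" using t by (simp add: B_def F2.span_base)
      ultimately have "(f + b t) + b t \<in> F2.span B" by (rule F2.span_add)
      then show ?thesis by (simp add: add.assoc)
    qed (simp add: F2.span_zero)
  qed
  moreover have "F2.span B \<subseteq> U"
    unfolding U_def using \<open>B \<subseteq> U - {0}\<close> by (intro F2.span_minimal) (auto simp: U_def)
  ultimately have "F2.span B = F2.span L" by (auto simp: U_def)
  moreover obtain gs where "set gs = B" "distinct gs" using finite_distinct_list[OF fin] by blast
  moreover have "F2.independent B"
    using \<open>B \<subseteq> U - {0}\<close> fin inj by (intro independent_distinct_LT) auto
  ultimately show ?thesis using inj by (auto simp: LT_basis_def)
qed

end

section \<open>Division of linear polynomials by a basis with distinct leading terms\<close>

locale division = ordered_terms \<sigma> for \<sigma> :: "'n::finite pterm rel" +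
  fixes L :: "'n bpoly set" and gs :: "'n bpoly list"
  assumes L_linear: "L \<subseteq> linear_bpolys" and basis: "LT_basis \<sigma> L gs"
begin

lemma span_gs: "F2.span (set gs) = F2.span L"
  using basis by (simp add: LT_basis_def)

lemma gs_linear: "set gs \<subseteq> linear_bpolys"
  using span_linear[OF L_linear] F2.span_superset[of "set gs"] by (simp add: span_gs)

lemma zero_notin_gs: "0 \<notin> set gs"
  using basis F2.dependent_zero by (auto simp: LT_basis_def)

lemma LT_span_gs: "h \<in> F2.span L \<Longrightarrow> h \<noteq> 0 \<Longrightarrow> LT \<sigma> h \<in> LT \<sigma> ` set gs"
  by (rule LT_span) (use basis zero_notin_gs span_gs in \<open>auto simp: LT_basis_def\<close>)

text \<open>Only 1 itself has the least term as its leading term. So inconsistency of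
  \<open>L\<close> shows in the basis as an explicit divisor 1.\<close>

lemma one_in_span_iff: "1 \<in> F2.span L \<longleftrightarrow> 1 \<in> set gs"
proof
  assume "1 \<in> F2.span L"
  then have "0 \<in> LT \<sigma> ` set gs" using LT_span_gs[of 1] by simp
  then obtain g where "g \<in> set gs" "LT \<sigma> g = 0" by auto
  then show "1 \<in> set gs" using LT_eq_0_imp[of g] zero_notin_gs by auto
next
  assume "1 \<in> set gs"
  then show "1 \<in> F2.span L" using F2.span_base span_gs by blast
qed

definition reducible :: "'n pterm \<Rightarrow> bool" where
  "reducible t \<longleftrightarrow> (\<exists>g\<in>set gs. \<exists>u. t = u + LT \<sigma> g)"

text \<open>The space of linear normal forms. It is the witness for the complement required by
  \<open>reduced_igs\<close>.\<close>

definition normal :: "'n bpoly set" where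
  "normal = {h \<in> linear_bpolys. \<forall>t\<in>supp h. \<not> reducible t}"

lemma normal_subspace: "F2.subspace normal"
  by (auto simp: F2_subspace_iff normal_def linear_bpolys_add in_supp_add)

lemma normal_add: "f \<in> normal \<Longrightarrow> g \<in> normal \<Longrightarrow> f + g \<in> normal"
  using normal_subspace F2.subspace_add by blast

text \<open>The leading term of a nonzero element of the span is that of a basis element, hence
  reducible.\<close>

lemma normal_span: "h \<in> normal \<Longrightarrow> h \<in> F2.span L \<Longrightarrow> h = 0"
proof (rule ccontr)
  assume h: "h \<in> normal" "h \<in> F2.span L" "h \<noteq> 0"
  then obtain g where "g \<in> set gs" "LT \<sigma> h = LT \<sigma> g" using LT_span_gs by blast
  then have "reducible (LT \<sigma> h)" unfolding reducible_def by (metis add_0)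
  then show False using h LT_in_supp[OF h(3)] by (auto simp: normal_def)
qed

lemma one_normal: "1 \<notin> F2.span L \<Longrightarrow> 1 \<in> normal"
proof -
  assume "1 \<notin> F2.span L"
  then have "1 \<notin> set gs" by (simp add: one_in_span_iff)
  then have ne: "LT \<sigma> g \<noteq> 0" if "g \<in> set gs" for g
    using that LT_eq_0_imp[of g] zero_notin_gs by blast
  have "v = 0" if "0 = u + v" for u v :: "'n pterm"
  proof (rule poly_mapping_eqI)
    show "Poly_Mapping.lookup v i = Poly_Mapping.lookup 0 i" for i
      using arg_cong[OF that, of "\<lambda>t. Poly_Mapping.lookup t i"] by (simp add: lookup_add)
  qed
  with ne have "\<not> reducible 0" unfolding reducible_def by blast
  then show ?thesis by (simp add: normal_def)
qed

text \<open>A divisor 1 makes every term reducible. Consequently a pass of GGCP on an inconsistent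
  \<open>L\<close> leaves no edges.\<close>

lemma normal_trivial: "1 \<in> F2.span L \<Longrightarrow> h \<in> normal \<Longrightarrow> h = 0"
proof -
  assume "1 \<in> F2.span L" and h: "h \<in> normal"
  then have "1 \<in> set gs" by (simp add: one_in_span_iff)
  then have "reducible t" for t unfolding reducible_def by (metis LT_one add_0_right)
  then have "supp h = {}" using h by (auto simp: normal_def)
  then show "h = 0" by simp
qed

text \<open>A linear leading term is divided either by 1, which removes just this term, or by an
  equal leading term, with cofactor 1; either way the rest stays linear. Only the second kind of
  step is the addition of \<open>g\<close> and respects congruence modulo the span, hence the
  condition on the last claim.\<close>

lemma div_step_Some:
  fixes v :: "'n f2poly"
  assumes v: "v \<noteq> 0" "Poly_Mapping.keys v \<subseteq> lin_terms" and g: "g \<in> set gs" "poly_LT \<sigma> v = u + LT \<sigma> g"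
  defines "v' \<equiv> v - Poly_Mapping.single (poly_LT \<sigma> v - LT \<sigma> g) 1 * sqfree_rep g"
  shows "\<And>s. s \<in> Poly_Mapping.keys v' \<Longrightarrow> s \<in> lin_terms \<and> (s, poly_LT \<sigma> v) \<in> \<sigma> \<and> s \<noteq> poly_LT \<sigma> v"
    and "1 \<notin> set gs \<Longrightarrow> abs_bpoly v' = abs_bpoly v + g"
proof -
  define m where "m = poly_LT \<sigma> v"
  have m: "m \<in> Poly_Mapping.keys v" "m \<in> lin_terms"
    using poly_LT_in_keys[OF v(1)] v(2) by (auto simp: m_def)
  have g0: "g \<noteq> 0" using g(1) zero_notin_gs by auto
  have lt: "LT \<sigma> g \<in> supp g" "supp g \<subseteq> lin_terms"
    using LT_in_supp[OF g0] gs_linear g(1) linear_iff_supp by auto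
  have diff: "m - LT \<sigma> g = u" using g(2) by (simp add: m_def)
  have "(\<forall>s\<in>Poly_Mapping.keys v'. s \<in> lin_terms \<and> (s, m) \<in> \<sigma> \<and> s \<noteq> m) \<and>
    (1 \<notin> set gs \<longrightarrow> abs_bpoly v' = abs_bpoly v + g)"
  proof (cases "LT \<sigma> g = 0")
    case True
    then have "g = 1" using LT_eq_0_imp[OF g0] by simp
    moreover have "sqfree_rep (1 :: 'n bpoly) = 1"
      using sqfree_rep_abs[of 1] by (simp add: abs_bpoly_one sqfree_def)
    ultimately have "v' = v + Poly_Mapping.single m 1"
      using True by (simp add: v'_def m_def f2poly_minus)
    then have "s \<in> Poly_Mapping.keys v' \<longleftrightarrow> s \<in> Poly_Mapping.keys v \<and> s \<noteq> m" for s
      using m(1) by (auto simp: keys_f2poly_add)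
    then show ?thesis
      using v(2) poly_LT_max[OF v(1)] g(1) \<open>g = 1\<close> by (auto simp: m_def)
  next
    case False
    then obtain j where j: "LT \<sigma> g = Poly_Mapping.single j 1" using lt by (auto simp: lin_terms_def)
    have mu: "m = u + Poly_Mapping.single j 1" using g(2) j by (simp add: m_def)
    then have "Poly_Mapping.lookup m j \<ge> 1" by (simp add: lookup_add)
    then have "m = Poly_Mapping.single j 1"
      using m(2) by (auto simp: lin_terms_def lookup_single when_def split: if_splits)
    then have "u = 0" "LT \<sigma> g = m" using mu j by simp_all
    then have v': "v' = v + sqfree_rep g"
      using diff by (simp add: v'_def m_def f2poly_minus)
    have "s \<in> lin_terms \<and> (s, m) \<in> \<sigma> \<and> s \<noteq> m" if "s \<in> Poly_Mapping.keys v'" for s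
    proof -
      have s: "(s \<in> Poly_Mapping.keys v) \<noteq> (s \<in> supp g)"
        using that by (simp add: v' keys_f2poly_add supp_def)
      then have "s \<noteq> m" using m(1) lt(1) \<open>LT \<sigma> g = m\<close> by auto
      moreover have "(s, m) \<in> \<sigma>"
        using s poly_LT_max[OF v(1)] LT_max[of s g] \<open>LT \<sigma> g = m\<close> by (auto simp: m_def)
      ultimately show ?thesis using s v(2) lt(2) by auto
    qed
    then show ?thesis by (simp add: v' abs_bpoly_add)
  qed
  then show "\<And>s. s \<in> Poly_Mapping.keys v' \<Longrightarrow> s \<in> lin_terms \<and> (s, poly_LT \<sigma> v) \<in> \<sigma> \<and> s \<noteq> poly_LT \<sigma> v"
    and "1 \<notin> set gs \<Longrightarrow> abs_bpoly v' = abs_bpoly v + g" by (auto simp: m_def)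
qed

definition div_inv :: "'n bpoly \<Rightarrow> 'n f2poly \<times> 'n f2poly \<Rightarrow> bool" where
  "div_inv f = (\<lambda>(v, r). Poly_Mapping.keys v \<subseteq> lin_terms \<and> Poly_Mapping.keys r \<subseteq> lin_terms \<and>
     (\<forall>t\<in>Poly_Mapping.keys r. \<not> reducible t) \<and>
     (1 \<notin> set gs \<longrightarrow> f + (abs_bpoly v + abs_bpoly r) \<in> F2.span L))"

lemma div_step_inv:
  assumes inv: "div_inv f (v, r)" and v: "v \<noteq> 0"
    and step: "div_step \<sigma> (map sqfree_rep gs) (v, r) = (v', r')"
  shows "div_inv f (v', r') \<and> rk (Poly_Mapping.keys v') < rk (Poly_Mapping.keys v)"
proof -
  let ?m = "poly_LT \<sigma> v"
  let ?P = "\<lambda>g :: 'n f2poly. g \<noteq> 0 \<and> (\<exists>u. ?m = u + poly_LT \<sigma> g)"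
  have vl: "Poly_Mapping.keys v \<subseteq> lin_terms" and rl: "Poly_Mapping.keys r \<subseteq> lin_terms"
    and rn: "\<forall>t\<in>Poly_Mapping.keys r. \<not> reducible t"
    and sp: "1 \<notin> set gs \<Longrightarrow> f + (abs_bpoly v + abs_bpoly r) \<in> F2.span L"
    using inv by (auto simp: div_inv_def)
  have m: "?m \<in> Poly_Mapping.keys v" "?m \<in> lin_terms" using poly_LT_in_keys[OF v] vl by auto
  show ?thesis
  proof (cases "List.find ?P (map sqfree_rep gs)")
    case None
    then have nd: "\<not> reducible ?m"
      using zero_notin_gs by (force simp: find_None_iff reducible_def LT_def sqfree_rep_eq_0)
    have v': "v' = v + Poly_Mapping.single ?m 1" "r' = r + Poly_Mapping.single ?m 1"
      using step None by (simp_all add: div_step_def f2poly_minus)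
    have kv: "s \<in> Poly_Mapping.keys v' \<longleftrightarrow> s \<in> Poly_Mapping.keys v \<and> s \<noteq> ?m" for s
      using m(1) by (auto simp: v' keys_f2poly_add)
    have kr: "s \<in> Poly_Mapping.keys r \<or> s = ?m" if "s \<in> Poly_Mapping.keys r'" for s
      using that by (auto simp: v' keys_f2poly_add)
    have "rk (Poly_Mapping.keys v') < rk (Poly_Mapping.keys v)"
      by (rule rk_less[OF m]) (use kv poly_LT_max[OF v] in auto)
    moreover have "abs_bpoly v' + abs_bpoly r' = abs_bpoly v + abs_bpoly r"
      by (simp add: v' abs_bpoly_add add_ac)
    ultimately show ?thesis
      using vl rl rn sp kv kr m(2) nd by (fastforce simp: div_inv_def)
  next
    case (Some p)
    then obtain i where "i < length (map sqfree_rep gs)" "?P (map sqfree_rep gs ! i)" "p = map sqfree_rep gs ! i"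
      unfolding find_Some_iff by blast
    then have "p \<in> set (map sqfree_rep gs)" "?P p"
      by (simp_all only: nth_mem simp_thms)
    then obtain g where g: "g \<in> set gs" "p = sqfree_rep g" "?P p" by auto
    then obtain u where u: "?m = u + LT \<sigma> g" by (auto simp: LT_def)
    have v': "v' = v - Poly_Mapping.single (?m - LT \<sigma> g) 1 * sqfree_rep g" "r' = r"
      using step Some g(2) by (simp_all add: div_step_def LT_def)
    note st = div_step_Some[OF v vl g(1) u, folded v'(1)]
    have "rk (Poly_Mapping.keys v') < rk (Poly_Mapping.keys v)"
      by (rule rk_less[OF m]) (use st in blast)
    moreover have "f + (abs_bpoly v' + abs_bpoly r) \<in> F2.span L" if "1 \<notin> set gs"
    proof -
      have "g \<in> F2.span L" using g(1) F2.span_base span_gs by blast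
      from F2.span_add[OF sp[OF that] this] show ?thesis
        by (simp add: st(2)[OF that] add_ac)
    qed
    ultimately show ?thesis
      using st(1) rl rn v'(2) by (auto simp: div_inv_def)
  qed
qed

text \<open>The loop is partial, so its end is established first, with \<open>rk\<close> as measure;
  both claims then read off the invariant at \<open>v = 0\<close>.\<close>

lemma NR_facts:
  assumes f: "f \<in> linear_bpolys"
  shows NR_normal: "NR \<sigma> f gs \<in> normal"
    and NR_cong: "1 \<notin> F2.span L \<Longrightarrow> f + NR \<sigma> f gs \<in> F2.span L"
proof -
  let ?b = "\<lambda>(v :: 'n f2poly, r :: 'n f2poly). v \<noteq> 0"
  let ?c = "div_step \<sigma> (map sqfree_rep gs)"
  let ?s = "(sqfree_rep f, 0)"
  have init: "div_inv f ?s"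
    using f by (simp add: div_inv_def linear_iff_supp supp_def abs_bpoly_zero F2.span_zero)
  have step: "div_inv f (?c x) \<and> rk (Poly_Mapping.keys (fst (?c x))) < rk (Poly_Mapping.keys (fst x))"
    if "div_inv f x" "?b x" for x
    using that div_step_inv[of f "fst x" "snd x" "fst (?c x)" "snd (?c x)"]
    by (cases x) auto
  obtain x where x: "while_option ?b ?c ?s = Some x"
    using measure_while_option_Some[of "div_inv f" ?b ?c "\<lambda>x. rk (Poly_Mapping.keys (fst x))", OF step init]
    by blast
  obtain v r where vr: "x = (v, r)" by (cases x)
  have inv: "div_inv f x"
    by (rule while_option_rule[where P = "div_inv f", OF _ x init]) (use step in blast)
  have "v = 0" using while_option_stop[OF x] vr by simp
  have nr: "NR \<sigma> f gs = abs_bpoly r" using x vr by (simp add: NR_def)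
  have r: "Poly_Mapping.keys r \<subseteq> lin_terms" "\<forall>t\<in>Poly_Mapping.keys r. \<not> reducible t"
    and sp: "1 \<notin> set gs \<Longrightarrow> f + abs_bpoly r \<in> F2.span L"
    using inv vr \<open>v = 0\<close> by (auto simp: div_inv_def abs_bpoly_zero)
  have "supp (abs_bpoly r) = Poly_Mapping.keys r" using supp_abs[OF sqfree_lin[OF r(1)]] .
  then show "NR \<sigma> f gs \<in> normal" using r by (simp add: nr normal_def linear_abs)
  show "f + NR \<sigma> f gs \<in> F2.span L" if "1 \<notin> F2.span L"
    using sp that by (simp add: nr one_in_span_iff)
qed

text \<open>The two sides differ by an element that is normal and in the span, hence by 0. This
  carries the contraposition symmetry of the edges over to their remainders.\<close>

lemma NR_add_one:
  assumes f: "f \<in> linear_bpolys" and one: "1 \<notin> F2.span L"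
  shows "NR \<sigma> (f + 1) gs = NR \<sigma> f gs + 1"
proof -
  have f1: "f + 1 \<in> linear_bpolys" using f by (simp add: linear_bpolys_add)
  have "(f + NR \<sigma> f gs) + (f + 1 + NR \<sigma> (f + 1) gs) \<in> F2.span L"
    using NR_cong[OF f one] NR_cong[OF f1 one] by (rule F2.span_add)
  moreover have "(f + NR \<sigma> f gs) + (f + 1 + NR \<sigma> (f + 1) gs) = NR \<sigma> (f + 1) gs + (NR \<sigma> f gs + 1)"
    by (simp add: add_ac)
  moreover have "NR \<sigma> (f + 1) gs + (NR \<sigma> f gs + 1) \<in> normal"
    using NR_normal f f1 one_normal[OF one] by (intro normal_add)
  ultimately show ?thesis using normal_span by fastforce
qed

end

section \<open>Solutions of implication graph structures\<close>

lemma even_card_involution: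
  assumes "finite A" "\<And>x. x \<in> A \<Longrightarrow> h x \<in> A \<and> h (h x) = x \<and> h x \<noteq> x"
  shows "even (card A)"
  using assms
proof (induction rule: finite_psubset_induct)
  case (psubset A)
  show ?case
  proof (cases "A = {}")
    case False
    then obtain x where x: "x \<in> A" by blast
    have hx: "h x \<in> A" "h (h x) = x" "h x \<noteq> x" using psubset.prems[OF x] by blast+
    let ?B = "A - {x, h x}"
    have "even (card ?B)"
    proof (rule psubset.IH)
      show "?B \<subset> A" using x by blast
      show "h y \<in> ?B \<and> h (h y) = y \<and> h y \<noteq> y" if "y \<in> ?B" for y
      proof -
        have y: "h y \<in> A" "h (h y) = y" "h y \<noteq> y" "y \<noteq> x" "y \<noteq> h x" using psubset.prems[of y] that by auto
        then have "h y \<noteq> x" "h y \<noteq> h x" using hx(2) by metis+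
        then show ?thesis using y by blast
      qed
    qed
    moreover have "card A = card ?B + card {x, h x}"
      using x hx(1) psubset.hyps by (metis card_Diff_subset card_mono empty_subsetI finite.emptyI finite.insertI insert_subset le_add_diff_inverse2)
    ultimately show ?thesis using hx(3) by simp
  qed simp
qed

definition sols :: "'n::finite bpoly set \<Rightarrow> 'n edges \<Rightarrow> (bit ^ 'n) set" where
  "sols L E = {a \<in> zeros L. \<forall>(f, g)\<in>E. bval a f = 0 \<longrightarrow> bval a g = 0}"

lemma zeros_Un: "zeros (L \<union> M) = zeros L \<inter> zeros M"
  by (auto simp: zeros_def)

lemma sols_Un: "sols (L \<union> M) E = sols L E \<inter> zeros M"
  by (auto simp: sols_def zeros_Un)

lemma zeros_F2_span: "zeros (F2.span L) = zeros L"
proof -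
  have "F2.span L \<subseteq> {f. bval a f = 0}" if "a \<in> zeros L" for a
    by (rule F2.span_minimal) (use that in \<open>auto simp: F2_subspace_iff zeros_def\<close>)
  then show ?thesis
    using F2.span_superset[of L] by (fastforce simp: zeros_def)
qed

lemma zeros_empty_if_one_in_span: "1 \<in> F2.span L \<Longrightarrow> zeros L = {}"
  unfolding zeros_F2_span[symmetric, of L] by (auto simp: zeros_def intro!: bexI[of _ 1])

text \<open>SOLVER can then return a point once no edges remain. A linear functional that is 1 at
  the constant 1 and 0 on a basis of \<open>L\<close> is evaluation at a point, whose coordinates
  are its values at the indeterminates.\<close>

lemma zeros_nonempty:
  fixes L :: "'n::finite bpoly set"
  assumes L: "L \<subseteq> linear_bpolys" and one: "1 \<notin> F2.span L"
  shows "zeros L \<noteq> {}"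
proof -
  interpret P: vector_space_pair bscale "(*) :: bit \<Rightarrow> bit \<Rightarrow> bit"
    by unfold_locales (simp_all add: algebra_simps)
  obtain B where B: "B \<subseteq> L" "F2.independent B" "L \<subseteq> F2.span B"
    using F2.maximal_independent_subset .
  have "1 \<notin> F2.span B" using one F2.span_mono[OF B(1)] by blast
  then have "F2.independent (insert 1 B)" "1 \<notin> B"
    using F2.independent_insertI[OF _ B(2)] F2.span_base by blast+
  then obtain \<phi> where \<phi>: "Vector_Spaces.linear bscale (*) \<phi>"
      "\<forall>x\<in>insert 1 B. \<phi> x = (if x = 1 then 1 else 0)"
    using P.linear_independent_extend[of "insert 1 B" "\<lambda>x. if x = 1 then 1 else 0"] by blast
  interpret \<phi>: Vector_Spaces.linear bscale "(*)" \<phi> by (rule \<phi>(1))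
  define a :: "bit ^ 'n" where "a = (\<chi> i. \<phi> (bvar i))"
  \<comment> \<open>Evaluation at \<open>a\<close> and the functional agree on the generators of
    \<open>linear_bpolys\<close>, hence on all of it.\<close>
  have "F2.subspace {f. bval a f = \<phi> f}"
    by (simp add: F2_subspace_iff \<phi>.add \<phi>.zero)
  then have "linear_bpolys \<subseteq> {f. bval a f = \<phi> f}"
    unfolding linear_bpolys_def
    by (rule F2.span_minimal[rotated]) (use \<phi>(2) in \<open>auto simp: a_def\<close>)
  moreover have "\<phi> f = 0" if "f \<in> L" for f
  proof (rule \<phi>.eq_0_on_span)
    show "f \<in> F2.span B" using that B(3) by blast
    show "\<phi> x = 0" if "x \<in> B" for x using that \<phi>(2) \<open>1 \<notin> B\<close> by auto
  qed
  ultimately have "a \<in> zeros L" using L by (auto simp: zeros_def)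
  then show ?thesis by blast
qed

text \<open>The product \<open>f * g\<close> vanishes at a point iff \<open>g\<close> vanishes there
  whenever \<open>f + 1\<close> does, which is the implication that the edge stands for.\<close>

lemma is_igs_sols:
  assumes "is_igs F (L, V, E)"
  shows "sols L E = sat_set F"
proof -
  define P where "P = {f * g | f g. (f + 1, g) \<in> E}"
  have "sat_set F = zeros {p + q | p q. p \<in> ideal.span L \<and> q \<in> ideal.span P}"
    using assms zeros_formula_ideal[of F] by (simp add: is_igs_def P_def)
  also have "\<dots> = zeros L \<inter> zeros P"
  proof -
    have "p + 0 \<in> {p + q | p q. p \<in> ideal.span L \<and> q \<in> ideal.span P}"
      "0 + q \<in> {p + q | p q. p \<in> ideal.span L \<and> q \<in> ideal.span P}"
      if "p \<in> ideal.span L" "q \<in> ideal.span P" for p q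
      using that ideal.span_zero by blast+
    then have "zeros {p + q | p q. p \<in> ideal.span L \<and> q \<in> ideal.span P}
        = zeros (ideal.span L) \<inter> zeros (ideal.span P)"
      by (auto simp: zeros_def) (metis ideal.span_zero add_0_left add_0_right)+
    then show ?thesis by (simp add: zeros_ideal_span)
  qed
  also have "a \<in> zeros P \<longleftrightarrow> (\<forall>(f, g)\<in>E. bval a f = 0 \<longrightarrow> bval a g = 0)" for a
  proof -
    have "a \<in> zeros P \<longleftrightarrow> (\<forall>f g. (f + 1, g) \<in> E \<longrightarrow> bval a f = 0 \<or> bval a g = 0)"
    proof -
      have "a \<in> zeros P \<longleftrightarrow> (\<forall>f g. (f + 1, g) \<in> E \<longrightarrow> bval a (f * g) = 0)"
        unfolding P_def zeros_def by blast
      then show ?thesis by (simp only: bval_mult mult_eq_0_iff)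
    qed
    \<comment> \<open>Adding 1 is an involution, so \<open>f + 1\<close> may be renamed to
      \<open>f\<close>.\<close>
    also have "\<dots> \<longleftrightarrow> (\<forall>f g. (f, g) \<in> E \<longrightarrow> bval a (f + 1) = 0 \<or> bval a g = 0)"
      by (metis add.assoc add_0_right bpoly_add_self)
    finally have *: "a \<in> zeros P \<longleftrightarrow> (\<forall>f g. (f, g) \<in> E \<longrightarrow> bval a (f + 1) = 0 \<or> bval a g = 0)" .
    have "bval a (f + 1) = 0 \<longleftrightarrow> bval a f \<noteq> 0" for f
      by (simp add: bit_add_eq_0_iff)
    then show ?thesis unfolding * by blast
  qed
  then have "zeros L \<inter> zeros P = sols L E" by (auto simp: sols_def)
  finally show ?thesis by simp
qed

section \<open>Propagation along paths and in strongly connected components\<close>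

lemma path_vanishes:
  assumes "\<forall>(f, g)\<in>E. bval a f = 0 \<longrightarrow> bval a g = 0" "is_path V E p" "bval a (hd p) = 0" "x \<in> set p"
  shows "bval a x = 0"
proof -
  have "successively (\<lambda>f g. (f, g) \<in> E) p" using assms(2) by (simp add: is_path_def)
  then show ?thesis using assms(3,4)
    by (induction p rule: induct_list012) (use assms(1) in auto)
qed

lemma path_vanishes_last:
  assumes "\<forall>(f, g)\<in>E. bval a f = 0 \<longrightarrow> bval a g = 0" "is_path V E p" "bval a x = 0" "x \<in> set p"
  shows "bval a (last p) = 0"
proof -
  have "successively (\<lambda>f g. (f, g) \<in> E) p" using assms(2) by (simp add: is_path_def)
  moreover have "x = hd p \<or> x \<in> set (tl p)" using assms(4) by (cases p) auto
  ultimately show ?thesis using assms(3,4)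
  proof (induction p arbitrary: x rule: induct_list012)
    case (3 y z zs)
    then show ?case using assms(1) by (cases "x = y") fastforce+
  qed auto
qed

lemma connected_refl: "f \<in> V \<Longrightarrow> connected_by_path V E f f"
  unfolding connected_by_path_def by (rule exI[of _ "[f]"]) (simp add: is_path_def)

lemma connected_in_V: "connected_by_path V E f g \<Longrightarrow> f \<in> V \<and> g \<in> V"
  unfolding connected_by_path_def is_path_def by auto

lemma connected_vanishes:
  assumes "a \<in> sols L E" "connected_by_path V E f g" "bval a f = 0"
  shows "bval a g = 0"
proof -
  obtain p where "is_path V E p" "hd p = f" "last p = g"
    using assms(2) by (auto simp: connected_by_path_def)
  then show ?thesis
    using path_vanishes[of E a V p g] assms by (auto simp: sols_def is_path_def)
qed

lemma descendants_vanish: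
  assumes "a \<in> sols L E" "bval a f = 0"
  shows "a \<in> zeros (descendants V E f)"
  using assms connected_vanishes[OF assms(1)] by (auto simp: zeros_def descendants_def)

text \<open>If \<open>f\<close> were 0 at a solution, so would be \<open>f + 1\<close>, or both
  \<open>g\<close> and \<open>g + 1\<close>.\<close>

lemma tFLS_vanish:
  assumes "a \<in> sols L E"
  shows "a \<in> zeros {f + 1 | f. f \<in> tFLS V E}"
proof -
  have "bval a f = 1" if f: "f \<in> tFLS V E" for f
  proof (rule ccontr)
    assume "bval a f \<noteq> 1"
    then have "bval a f = 0" by simp
    then have *: "bval a g = 0" if "connected_by_path V E f g" for g
      using connected_vanishes[OF assms that] by blast
    have "bval a (f + 1) = 1" using \<open>bval a f = 0\<close> by simp
    then obtain g where "connected_by_path V E f g" "connected_by_path V E f (g + 1)"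
      using f * by (force simp: tFLS_def)
    from this[THEN *] show False by simp
  qed
  then show ?thesis by (auto simp: zeros_def)
qed

lemma scc_elim:
  assumes "S \<in> sccs V E"
  obtains h where "h \<in> V"
    "S = {g \<in> V. connected_by_path V E h g \<and> connected_by_path V E g h}"
  using assms that by (auto simp: sccs_def quotient_def Image_def)

lemma scc_nonempty: "S \<in> sccs V E \<Longrightarrow> \<exists>f. f \<in> S"
  using connected_refl by (elim scc_elim) blast

lemma scc_subset: "S \<in> sccs V E \<Longrightarrow> S \<subseteq> V"
  by (elim scc_elim) blast

lemma scc_vals_eq:
  assumes "a \<in> sols L E" "S \<in> sccs V E" "f \<in> S" "g \<in> S"
  shows "bval a f = bval a g"
proof -
  obtain h where "S = {g \<in> V. connected_by_path V E h g \<and> connected_by_path V E g h}"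
    using assms(2) by (rule scc_elim)
  then have "bval a f = 0 \<longleftrightarrow> bval a h = 0" "bval a g = 0 \<longleftrightarrow> bval a h = 0"
    using assms(3,4) connected_vanishes[OF assms(1)] by blast+
  then show ?thesis by (intro iffD2[OF bit_eq_iff_zero_iff]) blast
qed

lemma scc_linerals_elim:
  assumes "scc_linerals V E M" "h \<in> M"
  obtains S f g where "S \<in> sccs V E" "f \<in> S" "g \<in> S" "f \<noteq> g" "h = f + g"
  using assms unfolding scc_linerals_def by blast

lemma scc_linerals_vanish:
  assumes "a \<in> sols L E" "scc_linerals V E M"
  shows "a \<in> zeros M"
proof -
  have "bval a h = 0" if h: "h \<in> M" for h
  proof -
    obtain S f g where "S \<in> sccs V E" "f \<in> S" "g \<in> S" "h = f + g"
      by (rule scc_linerals_elim[OF assms(2) h])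
    then show ?thesis using scc_vals_eq[OF assms(1), of S V f g] by (simp add: bit_add_eq_0_iff)
  qed
  then show ?thesis by (simp add: zeros_def)
qed

lemma scc_linerals_exists: "\<exists>M. scc_linerals V E M"
proof -
  have "\<forall>S\<in>sccs V E. \<exists>f. f \<in> S" using scc_nonempty by blast
  then obtain c where "\<forall>S\<in>sccs V E. c S \<in> S" by (auto dest: bchoice)
  then show ?thesis unfolding scc_linerals_def by blast
qed

section \<open>The invariants of the procedures\<close>

text \<open>What survives of an IGS without reference to a formula; the condition on the ideal is
  replaced by keeping track of \<open>sols\<close>. \<open>E_skew\<close> is contraposition, i.e.
  condition (2) with \<open>f + 1\<close> in place of \<open>f\<close>.\<close>

locale skew_igs =
  fixes L V :: "'n::finite bpoly set" and E :: "'n edges"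
  assumes L_linear: "L \<subseteq> linear_bpolys" and V_linear: "V \<subseteq> linear_bpolys"
    and E_subset: "E \<subseteq> V \<times> V"
    and E_skew: "(f, g) \<in> E \<Longrightarrow> (g + 1, f + 1) \<in> E"

lemma skew_igs_add:
  "skew_igs L V E \<Longrightarrow> M \<subseteq> linear_bpolys \<Longrightarrow> skew_igs (L \<union> M) V E"
  unfolding skew_igs_def by blast

lemma is_igs_skew: "is_igs F (L, V, E) \<Longrightarrow> skew_igs L V E"
  unfolding is_igs_def skew_igs_def
  by (auto simp: add.assoc)

text \<open>\<open>N\<close> stands for the normal forms; quantifying over it frees the later stages
  from the ordering and the basis. The guard on \<open>1 \<in> N\<close> admits an inconsistent
  \<open>L\<close>, for which \<open>V\<close> must then be empty.\<close>

locale reduced_igs = skew_igs L V E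
  for L V :: "'n::finite bpoly set" and E :: "'n edges" +
  assumes V_eq: "V = fst ` E \<union> snd ` E"
    and E_irrefl: "(f, g) \<in> E \<Longrightarrow> f \<noteq> g"
    and complement: "\<exists>N. F2.subspace N \<and> N \<inter> F2.span L = {0} \<and> V \<subseteq> N - {0, 1} \<and> (V \<noteq> {} \<longrightarrow> 1 \<in> N)"
begin

lemma finite_V: "finite V"
  using V_linear finite_linear_bpolys finite_subset by blast

text \<open>All these elements are nonzero members of \<open>N\<close>. They are what decisions,
  failed linerals and components add to \<open>L\<close>, so each such addition is proper
  progress.\<close>

lemma V_not_in_span:
  assumes "f \<in> V"
  shows "f \<notin> F2.span L" "f + 1 \<notin> F2.span L" "g \<in> V \<Longrightarrow> f \<noteq> g \<Longrightarrow> f + g \<notin> F2.span L"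
proof -
  obtain N where N: "F2.subspace N" "N \<inter> F2.span L = {0}" "V \<subseteq> N - {0, 1}" "1 \<in> N"
    using complement assms by blast
  have *: "h \<notin> F2.span L" if "h \<in> N" "h \<noteq> 0" for h using that N(2) by blast
  show "f \<notin> F2.span L" using assms N(3) by (intro *) auto
  show "f + 1 \<notin> F2.span L" using assms N by (intro * F2.subspace_add) auto
  show "g \<in> V \<Longrightarrow> f \<noteq> g \<Longrightarrow> f + g \<notin> F2.span L" using assms N by (intro * F2.subspace_add) auto
qed

text \<open>Every vertex is an endpoint of an edge, and the contraposed edge ends or starts in
  \<open>f + 1\<close>.\<close>

lemma V_add_one: "f \<in> V \<Longrightarrow> f + 1 \<in> V"
  using E_skew unfolding V_eq by force

lemma connected_skew:
  assumes "connected_by_path V E f g"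
  shows "connected_by_path V E (g + 1) (f + 1)"
proof -
  obtain p where p: "is_path V E p" "hd p = f" "last p = g"
    using assms by (auto simp: connected_by_path_def)
  have "successively (\<lambda>f g. (g + 1, f + 1) \<in> E) p"
    by (rule successively_mono[where P = "\<lambda>f g. (f, g) \<in> E"]) (use p E_skew in \<open>auto simp: is_path_def\<close>)
  then have "is_path V E (map (\<lambda>f. f + 1) (rev p))"
    using p(1) V_add_one by (auto simp: is_path_def successively_map)
  moreover have "hd (map (\<lambda>f. f + 1) (rev p)) = g + 1" "last (map (\<lambda>f. f + 1) (rev p)) = f + 1"
    using p by (auto simp: is_path_def hd_map hd_rev last_map last_rev)
  ultimately show ?thesis unfolding connected_by_path_def by blast
qed

text \<open>Adding \<open>1\<close> permutes the strongly connected components, and it fixes one of them if their number is odd.\<close>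

lemma odd_sccs_unsat:
  assumes "odd (card (sccs V E))"
  shows "sols L E = {}"
proof (rule ccontr)
  assume "sols L E \<noteq> {}"
  then obtain a where a: "a \<in> sols L E" by blast
  define neg :: "'n bpoly set \<Rightarrow> 'n bpoly set" where "neg = image (\<lambda>f. f + 1)"
  have add2: "f + 1 + 1 = f" for f :: "'n bpoly" by (simp add: add.assoc)
  have "finite (sccs V E)"
    by (rule finite_subset[of _ "Pow V"]) (use finite_V scc_subset in auto)
  moreover have "neg S \<in> sccs V E \<and> neg (neg S) = S \<and> neg S \<noteq> S" if S: "S \<in> sccs V E" for S
  proof (intro conjI)
    show "neg (neg S) = S" by (auto simp: neg_def add2 image_image)
    obtain h where h: "h \<in> V" "S = {g \<in> V. connected_by_path V E h g \<and> connected_by_path V E g h}"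
      using S by (rule scc_elim)
    have "neg S = {g \<in> V. connected_by_path V E (h + 1) g \<and> connected_by_path V E g (h + 1)}"
    proof
      show "neg S \<subseteq> {g \<in> V. connected_by_path V E (h + 1) g \<and> connected_by_path V E g (h + 1)}"
        using V_add_one connected_skew by (auto simp: neg_def h(2))
      show "{g \<in> V. connected_by_path V E (h + 1) g \<and> connected_by_path V E g (h + 1)} \<subseteq> neg S"
      proof
        fix g assume g: "g \<in> {g \<in> V. connected_by_path V E (h + 1) g \<and> connected_by_path V E g (h + 1)}"
        then have "g + 1 \<in> S"
          using V_add_one connected_skew[of "h + 1" g] connected_skew[of g "h + 1"]
          by (simp add: h(2) add2)
        then show "g \<in> neg S" unfolding neg_def by (intro image_eqI[of _ _ "g + 1"]) (simp_all add: add2)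
      qed
    qed
    then show "neg S \<in> sccs V E"
      using V_add_one[OF h(1)] connected_in_V by (fastforce simp: sccs_def quotient_def Image_def)
    \<comment> \<open>All members of a component agree at the solution \<open>a\<close>, whereas
      \<open>f\<close> and \<open>f + 1\<close> differ there.\<close>
    show "neg S \<noteq> S"
    proof
      assume "neg S = S"
      moreover obtain f where f: "f \<in> S" using scc_nonempty[OF S] by blast
      ultimately have "f + 1 \<in> S" by (auto simp: neg_def)
      from scc_vals_eq[OF a S f this] show False by (cases "bval a f") (simp_all add: add_bit_eq_xor)
    qed
  qed
  ultimately have "even (card (sccs V E))" by (rule even_card_involution)
  then show False using assms by blast
qed

lemma tFLS_linear: "{f + 1 | f. f \<in> tFLS V E} \<subseteq> linear_bpolys"
  using V_linear by (auto simp: tFLS_def linear_bpolys_add)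

lemma tFLS_not_in_span: "tFLS V E \<noteq> {} \<Longrightarrow> \<not> {f + 1 | f. f \<in> tFLS V E} \<subseteq> F2.span L"
  using V_not_in_span(2) by (auto simp: tFLS_def)

lemma scc_linerals_linear: "scc_linerals V E M \<Longrightarrow> M \<subseteq> linear_bpolys"
  using scc_subset V_linear by (blast elim: scc_linerals_elim intro: linear_bpolys_add)

lemma scc_linerals_not_in_span: "scc_linerals V E M \<Longrightarrow> M \<noteq> {} \<Longrightarrow> \<not> M \<subseteq> F2.span L"
  using V_not_in_span(3) scc_subset by (blast elim: scc_linerals_elim)

lemma descendants_linear: "f \<in> V \<Longrightarrow> descendants V E f \<subseteq> linear_bpolys"
  using V_linear by (auto simp: descendants_def)

text \<open>MaxBottleneck is the witness because it only maximizes over the finite nonempty set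
  \<open>V\<close>; the existence of a source or of a longest path would call for acyclicity, which
  \<open>reduced_igs\<close> does not contain.\<close>

lemma decision_exists: "E \<noteq> {} \<Longrightarrow> \<exists>L\<^sub>0 L\<^sub>1. decision V E L\<^sub>0 L\<^sub>1"
proof -
  assume "E \<noteq> {}"
  then have "V \<noteq> {}" using V_eq by auto
  \<comment> \<open>Should a cycle make a set of paths infinite, \<open>card\<close> yields 0, and
    the maximum still exists.\<close>
  let ?m = "\<lambda>h. paths_to V E h + paths_from V E h"
  obtain f where "f \<in> V" "\<forall>h\<in>V. ?m h \<le> ?m f"
  proof -
    have "Max (?m ` V) \<in> ?m ` V" using finite_V \<open>V \<noteq> {}\<close> by (intro Max_in) auto
    then obtain f where "f \<in> V" "Max (?m ` V) = ?m f" by blast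
    moreover have "\<forall>h\<in>V. ?m h \<le> Max (?m ` V)" using finite_V by (intro ballI Max_ge) auto
    ultimately show ?thesis using that by simp
  qed
  then have "is_arg_max ?m (\<lambda>h. h \<in> V) f" by (auto simp: is_arg_max_linorder)
  then show ?thesis using decision.MaxBottleneck by blast
qed

text \<open>For the first two heuristics the two branches are \<open>f = 0\<close> and
  \<open>f = 1\<close> with their consequences. Along a path values can only drop from 1 to 0:
  either they are constant, and all sums in \<open>L\<^sub>0\<close> vanish, or the path starts with
  1 and ends with 0, which is \<open>L\<^sub>1\<close>.\<close>

lemma decision_cases:
  assumes "decision V E L\<^sub>0 L\<^sub>1" "E \<noteq> {}"
  shows "L\<^sub>0 \<subseteq> linear_bpolys \<and> L\<^sub>1 \<subseteq> linear_bpolys \<and> \<not> L\<^sub>0 \<subseteq> F2.span L \<and> \<not> L\<^sub>1 \<subseteq> F2.span L \<and>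
    sols L E \<subseteq> zeros L\<^sub>0 \<union> zeros L\<^sub>1"
  using assms(1)
proof cases
  case (MaxReach f)
  then have f: "f \<in> V" by (simp add: is_arg_max_def sources_def)
  have "a \<in> zeros L\<^sub>0 \<union> zeros L\<^sub>1" if a: "a \<in> sols L E" for a
    using descendants_vanish[OF a, of f V] MaxReach by (cases "bval a f") (auto simp: zeros_def)
  moreover have "f \<in> L\<^sub>0" using MaxReach by (simp add: descendants_def)
  ultimately show ?thesis
    using MaxReach V_not_in_span[OF f] descendants_linear[OF f] f V_linear linear_bpolys_add[of f 1] by auto
next
  case (MaxBottleneck f)
  then have f: "f \<in> V" by (simp add: is_arg_max_def)
  have "a \<in> zeros L\<^sub>0 \<union> zeros L\<^sub>1" if a: "a \<in> sols L E" for a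
    using descendants_vanish[OF a, of f V] descendants_vanish[OF a, of "f + 1" V] MaxBottleneck
    by (cases "bval a f") (simp_all)
  moreover have "f \<in> L\<^sub>0" "f + 1 \<in> L\<^sub>1" using MaxBottleneck by (simp_all add: descendants_def)
  ultimately show ?thesis
    using MaxBottleneck V_not_in_span[OF f] descendants_linear[OF f] descendants_linear[OF V_add_one[OF f]]
    by blast
next
  case (MaxPath p)
  have p: "is_path V E p" and max: "is_path V E q \<Longrightarrow> length q \<le> length p" for q
    using MaxPath(3) by (auto simp: is_arg_max_linorder)
  obtain f g where fg: "(f, g) \<in> E" using assms(2) by auto
  \<comment> \<open>A path with one vertex would give \<open>L\<^sub>0 = {0}\<close> and no
    progress; maximality against a single edge excludes it.\<close>
  have "length p \<ge> 2" using max[of "[f, g]"] fg E_subset by (auto simp: is_path_def)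
  then obtain x y q where xy: "p = x # y # q" by (metis Suc_le_length_iff numeral_2_eq_2)
  have mem: "x \<in> V" "y \<in> V" "x \<noteq> y" "last p \<in> V"
    using p E_irrefl by (auto simp: is_path_def xy)
  have "a \<in> zeros L\<^sub>0 \<union> zeros L\<^sub>1" if a: "a \<in> sols L E" for a
  proof -
    have imp: "\<forall>(f, g)\<in>E. bval a f = 0 \<longrightarrow> bval a g = 0" using a by (simp add: sols_def)
    \<comment> \<open>In the first case the whole path is 0, in the second it is 1.\<close>
    consider "bval a (hd p) = 0" | "bval a (last p) = 1" | "bval a (hd p) = 1" "bval a (last p) = 0"
      by (cases "bval a (hd p)"; cases "bval a (last p)") auto
    then show ?thesis
    proof cases
      case 1
      then have "\<forall>z\<in>set p. bval a z = 0" using path_vanishes[OF imp p] by blast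
      then show ?thesis using 1 MaxPath by (auto simp: zeros_def)
    next
      case 2
      then have "bval a z = 1" if "z \<in> set p" for z
        using path_vanishes_last[OF imp p _ that] by (cases "bval a z") auto
      moreover from this[of "hd p"] have "bval a (hd p) = 1" by (simp add: xy)
      ultimately show ?thesis using MaxPath by (auto simp: zeros_def)
    next
      case 3
      then show ?thesis using MaxPath by (auto simp: zeros_def)
    qed
  qed
  moreover have "L\<^sub>0 \<subseteq> linear_bpolys"
    using MaxPath p V_linear xy by (auto simp: is_path_def intro!: linear_bpolys_add)
  moreover have "L\<^sub>1 \<subseteq> linear_bpolys"
    using MaxPath mem V_linear xy by (auto intro!: linear_bpolys_add)
  moreover have "x + y \<in> L\<^sub>0" "x + 1 \<in> L\<^sub>1" using MaxPath xy by auto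
  ultimately show ?thesis using V_not_in_span[OF mem(1)] mem by blast
qed

end

section \<open>One pass of GGCP\<close>

lemma ball_pair_conj:
  "(\<forall>(x, y)\<in>R. P x y \<and> Q x y) \<longleftrightarrow> (\<forall>(x, y)\<in>R. P x y) \<and> (\<forall>(x, y)\<in>R. Q x y)"
  by blast

text \<open>Every appended element is normal and nonzero, hence outside the span, which gives
  progress. At a zero of \<open>L\<close> each remainder has the value of its dividend, so the
  conditions on the edges become conditions on remainders; those with a constant side turn into
  linear equations or become trivial.\<close>

lemma (in skew_igs) ggcp_pass:
  assumes \<sigma>: "term_ordering \<sigma>" and basis: "LT_basis \<sigma> L gs" and pass: "ggcp_pass \<sigma> gs E = (L', V', E')"
  shows ggcp_pass_skew: "skew_igs L' V' E'"
    and ggcp_pass_sols: "sols L' E' = sols L E"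
    and ggcp_pass_span: "F2.span L \<subseteq> F2.span L'"
    and ggcp_pass_progress: "set gs \<noteq> L' \<Longrightarrow> F2.span L \<noteq> F2.span L'"
    and ggcp_pass_reduced: "set gs = L' \<Longrightarrow> reduced_igs L' V' E'"
proof -
  interpret division \<sigma> L gs
    by unfold_locales (use \<sigma> basis L_linear in auto)
  define n where "n f = NR \<sigma> f gs" for f
  define R where "R = {(n f, n g) | f g. (f, g) \<in> E}"
  define A where "A = {y | x y. (x, y) \<in> R \<and> x = 0 \<and> y \<noteq> 0} \<union> {x + 1 | x y. (x, y) \<in> R \<and> y = 1 \<and> x \<noteq> 1}"
  define E\<^sub>0 where "E\<^sub>0 = {(x, y) \<in> R. x \<notin> {0, 1} \<and> y \<notin> {0, 1} \<and> x \<noteq> y}"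
  have "set gs \<union> A = L' \<and> fst ` E\<^sub>0 \<union> snd ` E\<^sub>0 = V' \<and> E\<^sub>0 = E'"
    using pass unfolding ggcp_pass_def Let_def n_def[symmetric] R_def[symmetric] A_def E\<^sub>0_def
    by (auto simp only: prod.inject Un_assoc)
  then have L': "L' = set gs \<union> A" and V': "V' = fst ` E' \<union> snd ` E'"
    and E': "E' = {(x, y) \<in> R. x \<notin> {0, 1} \<and> y \<notin> {0, 1} \<and> x \<noteq> y}"
    unfolding E\<^sub>0_def by blast+
  have E_lin: "f \<in> linear_bpolys" "g \<in> linear_bpolys" if "(f, g) \<in> E" for f g
    using that E_subset V_linear by auto
  have R_normal: "x \<in> normal" "y \<in> normal" if "(x, y) \<in> R" for x y
    using that E_lin NR_normal by (auto simp: R_def n_def)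
  have A_normal: "h \<in> normal \<and> h \<noteq> 0" if "h \<in> A" for h
  proof -
    from that consider x where "(x, h) \<in> R" "h \<noteq> 0" | x where "(x, 1) \<in> R" "h = x + 1" "x \<noteq> 1"
      unfolding A_def by blast
    then show ?thesis by cases (use R_normal normal_add in auto)
  qed
  \<comment> \<open>A surviving edge has nonzero remainders, so \<open>L\<close> is consistent and
    \<open>NR_add_one\<close> applies.\<close>
  have one: "1 \<notin> F2.span L" if "(x, y) \<in> E'" for x y
    using that normal_trivial R_normal unfolding E' by blast
  have E'_skew: "(y + 1, x + 1) \<in> E'" if xy: "(x, y) \<in> E'" for x y
  proof -
    obtain f g where fg: "(f, g) \<in> E" "x = n f" "y = n g" using xy by (auto simp: E' R_def)
    have "n (f + 1) = x + 1" "n (g + 1) = y + 1"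
      using NR_add_one[OF _ one[OF xy]] E_lin[OF fg(1)] fg by (simp_all add: n_def)
    then have "(y + 1, x + 1) \<in> R" using E_skew[OF fg(1)] unfolding R_def by force
    moreover have "x + 1 \<noteq> 1" "y + 1 \<noteq> 1" using xy by (auto simp: E')
    ultimately show ?thesis using xy by (auto simp: E')
  qed
  have L'_linear: "L' \<subseteq> linear_bpolys"
    using gs_linear A_normal by (auto simp: L' normal_def)
  have V'_normal: "V' \<subseteq> normal - {0, 1}" using R_normal by (fastforce simp: V' E')
  show skew: "skew_igs L' V' E'"
  proof
    show "V' \<subseteq> linear_bpolys" using V'_normal by (auto simp: normal_def)
    show "E' \<subseteq> V' \<times> V'" unfolding V' by force
  qed (use L'_linear E'_skew in auto)
  show "F2.span L \<subseteq> F2.span L'"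
    using F2.span_mono[of "set gs" L'] span_gs by (auto simp: L')
  show "F2.span L \<noteq> F2.span L'" if ne: "set gs \<noteq> L'"
  proof -
    obtain h where "h \<in> A" using ne unfolding L' by blast
    then have "h \<notin> F2.span L" "h \<in> F2.span L'"
      using A_normal normal_span by (auto simp: L' F2.span_base)
    then show ?thesis by blast
  qed
  show "reduced_igs L' V' E'" if "set gs = L'"
  proof -
    have "F2.span L' = F2.span L" using span_gs that by simp
    moreover have "normal \<inter> F2.span L = {0}"
      using normal_span F2.span_zero F2.subspace_0[OF normal_subspace] by blast
    moreover have "V' \<noteq> {} \<longrightarrow> 1 \<in> normal" using one one_normal by (auto simp: V')
    ultimately have "\<exists>N. F2.subspace N \<and> N \<inter> F2.span L' = {0} \<and> V' \<subseteq> N - {0, 1} \<and> (V' \<noteq> {} \<longrightarrow> 1 \<in> N)"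
      using normal_subspace V'_normal by (intro exI[of _ normal]) simp
    then show ?thesis
      using V' by (intro reduced_igs.intro skew reduced_igs_axioms.intro) (auto simp: E')
  qed
  show "sols L' E' = sols L E"
  proof (rule set_eqI)
    fix a :: "bit ^ 'n"
    let ?imp = "\<lambda>f g. bval a f = 0 \<longrightarrow> bval a g = 0"
    have zL': "a \<in> zeros L' \<longleftrightarrow> a \<in> zeros L \<and> a \<in> zeros A"
      using zeros_F2_span[of L] zeros_F2_span[of "set gs"] span_gs by (simp add: L' zeros_Un)
    have "(\<forall>(f, g)\<in>E. ?imp f g) \<longleftrightarrow> a \<in> zeros A \<and> (\<forall>(x, y)\<in>E'. ?imp x y)" if a: "a \<in> zeros L"
    proof -
      \<comment> \<open>The zero \<open>a\<close> of \<open>L\<close> shows consistency, so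
        remainders are congruent to their dividends and have the same value at
        \<open>a\<close>.\<close>
      have one: "1 \<notin> F2.span L" using a zeros_empty_if_one_in_span by blast
      have n: "bval a (n f) = bval a f" if "f \<in> linear_bpolys" for f
      proof -
        have "a \<in> zeros (F2.span L)" using a by (simp only: zeros_F2_span)
        then have "bval a (f + n f) = 0"
          using NR_cong[OF that one] unfolding n_def zeros_def by blast
        then show ?thesis by (simp add: bit_add_eq_0_iff)
      qed
      have "(\<forall>(f, g)\<in>E. ?imp f g) \<longleftrightarrow> (\<forall>(x, y)\<in>R. ?imp x y)"
      proof -
        have "?imp (n f) (n g) \<longleftrightarrow> ?imp f g" if "(f, g) \<in> E" for f g
          using n E_lin[OF that] by simp
        then show ?thesis unfolding R_def by blast
      qed
      \<comment> \<open>\<open>x = 0\<close> forces \<open>y\<close> to vanish and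
        \<open>y = 1\<close> forces \<open>x\<close> to be 1 at \<open>a\<close>; the cases
        \<open>x = 1\<close>, \<open>y = 0\<close> and \<open>x = y\<close> hold trivially.\<close>
      also have "\<dots> \<longleftrightarrow> (\<forall>(x, y)\<in>R. (x = 0 \<and> y \<noteq> 0 \<longrightarrow> bval a y = 0) \<and> (y = 1 \<and> x \<noteq> 1 \<longrightarrow> bval a (x + 1) = 0) \<and>
          (x \<notin> {0, 1} \<and> y \<notin> {0, 1} \<and> x \<noteq> y \<longrightarrow> ?imp x y))"
      proof (intro ball_cong refl, clarify)
        fix x y :: "'n bpoly"
        show "?imp x y \<longleftrightarrow> (x = 0 \<and> y \<noteq> 0 \<longrightarrow> bval a y = 0) \<and> (y = 1 \<and> x \<noteq> 1 \<longrightarrow> bval a (x + 1) = 0) \<and>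
          (x \<notin> {0, 1} \<and> y \<notin> {0, 1} \<and> x \<noteq> y \<longrightarrow> ?imp x y)"
          by (cases "x = 0"; cases "y = 0"; cases "x = 1"; cases "y = 1") (auto simp: bit_add_eq_0_iff)
      qed
      also have "\<dots> \<longleftrightarrow> a \<in> zeros A \<and> (\<forall>(x, y)\<in>E'. ?imp x y)"
      proof -
        have "a \<in> zeros {y | x y. (x, y) \<in> R \<and> x = 0 \<and> y \<noteq> 0} \<longleftrightarrow>
            (\<forall>(x, y)\<in>R. x = 0 \<and> y \<noteq> 0 \<longrightarrow> bval a y = 0)"
          unfolding zeros_def by blast
        moreover have "a \<in> zeros {x + 1 | x y. (x, y) \<in> R \<and> y = 1 \<and> x \<noteq> 1} \<longleftrightarrow>
            (\<forall>(x, y)\<in>R. y = 1 \<and> x \<noteq> 1 \<longrightarrow> bval a (x + 1) = 0)"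
          unfolding zeros_def by blast
        moreover have "(\<forall>(x, y)\<in>E'. ?imp x y) \<longleftrightarrow>
            (\<forall>(x, y)\<in>R. x \<notin> {0, 1} \<and> y \<notin> {0, 1} \<and> x \<noteq> y \<longrightarrow> ?imp x y)"
          unfolding E' by blast
        ultimately show ?thesis
          unfolding A_def zeros_Un Int_iff by (simp only: ball_pair_conj conj_assoc)
      qed
      finally show ?thesis .
    qed
    then show "a \<in> sols L' E' \<longleftrightarrow> a \<in> sols L E" unfolding sols_def using zL' by blast
  qed
qed

section \<open>Termination and correctness of SOLVER\<close>

text \<open>A number of elements, not a codimension; a properly larger span lowers it by mere
  inclusion of finite sets.\<close>

definition corank :: "'n::finite bpoly set \<Rightarrow> nat" where
  "corank L = card (linear_bpolys - F2.span L)"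

lemma corank_mono: "F2.span L \<subseteq> F2.span L' \<Longrightarrow> corank L' \<le> corank L"
  unfolding corank_def by (rule card_mono) auto

lemma corank_less:
  assumes "F2.span L \<subseteq> F2.span L'" "F2.span L \<noteq> F2.span L'" "L' \<subseteq> linear_bpolys"
  shows "corank L' < corank L"
  unfolding corank_def by (rule psubset_card_mono) (use assms span_linear[OF assms(3)] in auto)

lemma corank_Un_less:
  assumes "L \<union> M \<subseteq> linear_bpolys" "\<not> M \<subseteq> F2.span L"
  shows "corank (L \<union> M) < corank L"
proof (rule corank_less[OF _ _ assms(1)])
  show "F2.span L \<subseteq> F2.span (L \<union> M)" by (rule F2.span_mono) simp
  show "F2.span L \<noteq> F2.span (L \<union> M)" using assms(2) F2.span_base by blast
qed

section \<open>Invariant, solutions and weight of a configuration\<close>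

fun igs_ok :: "'n::finite igs \<Rightarrow> bool" where
  "igs_ok (L, V, E) = skew_igs L V E"

fun igs_sols :: "'n::finite igs \<Rightarrow> (bit ^ 'n) set" where
  "igs_sols (L, V, E) = sols L E"

text \<open>A decision replaces one structure by two of smaller corank, so its weight has to exceed twice
  the weight of those; the factor 10 leaves room for the steps that keep the corank.\<close>

fun igs_weight :: "'n::finite igs \<Rightarrow> nat" where
  "igs_weight (L, V, E) = 10 * 3 ^ corank L"

fun reduced_ok :: "'n::finite igs \<Rightarrow> bool" where
  "reduced_ok (L, V, E) = reduced_igs L V E"

text \<open>At \<open>GGCP_Start\<close> new elements may have entered \<open>L\<close>, so the
  vertices need not be reduced modulo its span.\<close>

fun control_ok :: "'n::finite control \<Rightarrow> bool" where
  "control_ok (GGCP_Start G) = igs_ok G"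
| "control_ok (GGCP_Done G) = reduced_ok G"
| "control_ok (crGGCP_Done G) = reduced_ok G"
| "control_ok (No_Failed G) = reduced_ok G"
| "control_ok (Return r) = True"

fun control_sols :: "'n::finite control \<Rightarrow> (bit ^ 'n) set" where
  "control_sols (GGCP_Start G) = igs_sols G"
| "control_sols (GGCP_Done G) = igs_sols G"
| "control_sols (crGGCP_Done G) = igs_sols G"
| "control_sols (No_Failed G) = igs_sols G"
| "control_sols (Return UNSAT) = {}"
| "control_sols (Return (SAT a)) = {a}"

text \<open>The offsets 3, 2, 1, 0 pay for moving on with the same corank. \<open>Return\<close>
  weighs 1, so that a waiting call, which already weighs as much as its \<open>GGCP_Start\<close>,
  can be resumed at a smaller total.\<close>

fun control_weight :: "'n::finite control \<Rightarrow> nat" where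
  "control_weight (GGCP_Start G) = igs_weight G + 3"
| "control_weight (GGCP_Done G) = igs_weight G + 2"
| "control_weight (crGGCP_Done G) = igs_weight G + 1"
| "control_weight (No_Failed G) = igs_weight G"
| "control_weight (Return r) = 1"

definition config_ok :: "'n::finite config \<Rightarrow> bool" where
  "config_ok = (\<lambda>(c, st). control_ok c \<and> (\<forall>G\<in>set st. igs_ok G))"

definition config_sols :: "'n::finite config \<Rightarrow> (bit ^ 'n) set" where
  "config_sols = (\<lambda>(c, st). control_sols c \<union> (\<Union>G\<in>set st. igs_sols G))"

definition config_weight :: "'n::finite config \<Rightarrow> nat" where
  "config_weight = (\<lambda>(c, st). control_weight c + (\<Sum>G\<leftarrow>st. igs_weight G + 3))"

lemmas config_defs = config_ok_def config_sols_def config_weight_def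

lemma power3_less: "m < n \<Longrightarrow> 3 * 3 ^ m \<le> (3 :: nat) ^ n"
  using power_increasing[of "Suc m" n "3 :: nat"] by simp

text \<open>The span is everything here, so only the zero space can serve as complement.\<close>

lemma reduced_igs_unsat: "reduced_igs (insert 1 (range bvar)) {} {}"
proof -
  have "F2.subspace {0 :: 'n bpoly}" by (simp add: F2_subspace_iff)
  then show ?thesis
    by unfold_locales (auto intro!: exI[of _ "{0}"] F2.span_zero)
qed

lemma sols_if_one_in_span: "1 \<in> F2.span L \<Longrightarrow> sols L E = {}"
  using zeros_empty_if_one_in_span by (auto simp: sols_def)

text \<open>Inclusion instead of equality is forced by \<open>solver_sat\<close>, which keeps one of
  possibly many points, and by \<open>solver_first_sat\<close>, which drops a waiting call. All
  other steps preserve the set exactly.\<close>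

lemma solver_step_invariant:
  assumes \<sigma>: "term_ordering \<sigma>" and step: "solver_step \<sigma> c c'" and ok: "config_ok c"
  shows "config_ok c' \<and> config_weight c' < config_weight c \<and>
    config_sols c' \<subseteq> config_sols c \<and> (config_sols c' = {} \<longrightarrow> config_sols c = {})"
  using step
proof cases
  case (ggcp_goto L gs E L' V' E' V st)
  then interpret skew_igs L V E using ok by (simp add: config_defs)
  note pass = ggcp_pass[OF \<sigma> ggcp_goto(3,4)]
  have "corank L' < corank L"
    using pass(3) pass(4)[OF ggcp_goto(5)] skew_igs.L_linear[OF pass(1)] by (rule corank_less)
  then show ?thesis using ggcp_goto ok pass(1,2) by (simp add: config_defs)
next
  case (ggcp_return L gs E L' V' E' V st)
  then interpret skew_igs L V E using ok by (simp add: config_defs)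
  note pass = ggcp_pass[OF \<sigma> ggcp_return(3,4)]
  have "(3 :: nat) ^ corank L' \<le> 3 ^ corank L" using corank_mono[OF pass(3)] by (simp add: power_increasing)
  then show ?thesis using ggcp_return ok pass(2) pass(5)[OF ggcp_return(5)]
    by (simp add: config_defs less_Suc_eq_le)
next
  case (crggcp_odd V E L st)
  then interpret reduced_igs L V E using ok by (simp add: config_defs)
  let ?U = "insert 1 (range bvar) :: 'a bpoly set"
  have "F2.span L \<subseteq> F2.span ?U" using span_linear[OF L_linear] by (simp add: linear_bpolys_def)
  then have "(3 :: nat) ^ corank ?U \<le> 3 ^ corank L" using corank_mono by (simp add: power_increasing)
  moreover have "sols ?U {} = {}" by (rule sols_if_one_in_span) (simp add: F2.span_base)
  ultimately show ?thesis
    using crggcp_odd ok odd_sccs_unsat reduced_igs_unsat by (simp add: config_defs less_Suc_eq_le)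
next
  case (crggcp_goto V E M L st)
  then interpret reduced_igs L V E using ok by (simp add: config_defs)
  have lin: "M \<subseteq> linear_bpolys" by (rule scc_linerals_linear) fact
  have "corank (L \<union> M) < corank L"
    using lin L_linear scc_linerals_not_in_span crggcp_goto by (intro corank_Un_less) auto
  from power3_less[OF this] have "10 * 3 ^ corank (L \<union> M) + 1 < (10 :: nat) * 3 ^ corank L"
    using zero_less_power[of "3 :: nat" "corank (L \<union> M)"] by linarith
  moreover have "sols (L \<union> M) E = sols L E"
    using scc_linerals_vanish crggcp_goto by (auto simp: sols_Un)
  ultimately show ?thesis
    using crggcp_goto ok skew_igs_add[OF skew_igs_axioms lin] by (simp add: config_defs)
next
  case (crggcp_return V E L st)
  then show ?thesis using crggcp_return ok by (simp add: config_defs)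
next
  case (solver_failed V E L st)
  then interpret reduced_igs L V E using ok by (simp add: config_defs)
  let ?M = "{f + 1 | f. f \<in> tFLS V E}"
  have "corank (L \<union> ?M) < corank L"
    using tFLS_linear L_linear tFLS_not_in_span solver_failed by (intro corank_Un_less) auto
  from power3_less[OF this] have "10 * 3 ^ corank (L \<union> ?M) + 2 < (10 :: nat) * 3 ^ corank L"
    using zero_less_power[of "3 :: nat" "corank (L \<union> ?M)"] by linarith
  moreover have "sols (L \<union> ?M) E = sols L E"
    using tFLS_vanish by (auto simp: sols_Un)
  ultimately show ?thesis
    using solver_failed ok skew_igs_add[OF skew_igs_axioms tFLS_linear] by (simp add: config_defs)
next
  case (solver_no_failed V E L st)
  then show ?thesis using solver_no_failed ok by (simp add: config_defs)
next
  case (solver_unsat L V E st)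
  have "(0 :: nat) < 3 ^ corank L" by simp
  then have "1 < (10 :: nat) * 3 ^ corank L" by linarith
  then show ?thesis using solver_unsat ok sols_if_one_in_span[of L E] by (simp add: config_defs)
next
  case (solver_sat L E a V st)
  have "(0 :: nat) < 3 ^ corank L" by simp
  then have "1 < (10 :: nat) * 3 ^ corank L" by linarith
  then show ?thesis using solver_sat ok by (auto simp: config_defs sols_def)
next
  case (solver_decide L E V L0 L1 st)
  then interpret reduced_igs L V E using ok by (simp add: config_defs)
  note dec = decision_cases[OF solver_decide(5,4)]
  have "corank (L \<union> L0) < corank L" "corank (L \<union> L1) < corank L"
    using dec L_linear by (auto intro!: corank_Un_less)
  from this[THEN power3_less]
  have "10 * 3 ^ corank (L \<union> L0) + 10 * 3 ^ corank (L \<union> L1) + 6 < (10 :: nat) * 3 ^ corank L"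
    using zero_less_power[of "3 :: nat" "corank (L \<union> L0)"] zero_less_power[of "3 :: nat" "corank (L \<union> L1)"]
    by linarith
  moreover have "sols (L \<union> L0) E \<union> sols (L \<union> L1) E = sols L E"
    using dec by (auto simp: sols_Un)
  moreover have "skew_igs (L \<union> L0) V E" "skew_igs (L \<union> L1) V E"
    using dec by (auto intro: skew_igs_add[OF skew_igs_axioms])
  ultimately show ?thesis
    using solver_decide ok by (auto simp: config_defs)
next
  case (solver_first_sat a G st)
  then show ?thesis using ok by (cases G) (auto simp: config_defs)
next
  case (solver_first_unsat G st)
  then show ?thesis using ok by (auto simp: config_defs)
qed

text \<open>A run could only get stuck where a basis, representatives, a point or a decision must be
  chosen; the existence lemmas above cover these places.\<close>

lemma solver_step_progress:
  assumes \<sigma>: "term_ordering \<sigma>" and ok: "config_ok c"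
  shows "(\<exists>c'. solver_step \<sigma> c c') \<or> (\<exists>r. c = (Return r, []))"
proof -
  interpret ordered_terms \<sigma> by unfold_locales (rule \<sigma>)
  obtain x st where c: "c = (x, st)" by (cases c)
  show ?thesis
  proof (cases x)
    case (GGCP_Start G)
    obtain L V E where G: "G = (L, V, E)" by (cases G)
    then interpret skew_igs L V E using ok c GGCP_Start by (simp add: config_defs)
    obtain gs where gs: "LT_basis \<sigma> L gs" using LT_basis_exists[OF L_linear] by blast
    obtain L' V' E' where pass: "ggcp_pass \<sigma> gs E = (L', V', E')" by (cases "ggcp_pass \<sigma> gs E")
    show ?thesis
      unfolding c GGCP_Start G using ggcp_goto[OF gs pass] ggcp_return[OF gs pass] by blast
  next
    case (GGCP_Done G)
    obtain L V E where G: "G = (L, V, E)" by (cases G)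
    obtain M where "scc_linerals V E M" using scc_linerals_exists by blast
    then show ?thesis
      unfolding c GGCP_Done G using crggcp_odd crggcp_goto crggcp_return by blast
  next
    case (crGGCP_Done G)
    obtain L V E where G: "G = (L, V, E)" by (cases G)
    show ?thesis
      unfolding c crGGCP_Done G
      using solver_failed[of V E] solver_no_failed[of V E] by (cases "tFLS V E = {}") blast+
  next
    case (No_Failed G)
    obtain L V E where G: "G = (L, V, E)" by (cases G)
    then interpret reduced_igs L V E using ok c No_Failed by (simp add: config_defs)
    consider "1 \<in> F2.span L" | a where "1 \<notin> F2.span L" "E = {}" "a \<in> zeros L"
      | L\<^sub>0 L\<^sub>1 where "1 \<notin> F2.span L" "E \<noteq> {}" "decision V E L\<^sub>0 L\<^sub>1"
      using zeros_nonempty[OF L_linear] decision_exists by blast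
    then have "\<exists>c'. solver_step \<sigma> (No_Failed (L, V, E), st) c'"
    proof cases
      case 1
      then show ?thesis using solver_unsat by (intro exI)
    next
      case 2
      then show ?thesis using solver_sat by (intro exI)
    next
      case 3
      then show ?thesis using solver_decide by (intro exI)
    qed
    then show ?thesis unfolding c No_Failed G by blast
  next
    case (Return r)
    show ?thesis
    proof (cases st)
      case (Cons G st')
      have "\<exists>c'. solver_step \<sigma> (Return r, G # st') c'"
        by (cases r) (auto intro: solver_first_sat solver_first_unsat)
      then show ?thesis unfolding c Return Cons by blast
    qed (use c Return in blast)
  qed
qed

theorem proposition4p24:
  fixes F :: "'n::finite xnf" and L V :: "'n bpoly set" and E :: "('n bpoly \<times> 'n bpoly) set"
    and \<sigma> :: "'n pterm rel"
  assumes "two_xnf F" and "is_igs F (L, V, E)" and "term_ordering \<sigma>"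
  shows "solver_terminates \<sigma> (L, V, E) \<and>
    (\<forall>r. solver_returns \<sigma> (L, V, E) r \<longrightarrow>
       (r = UNSAT \<longleftrightarrow> sat_set F = {}) \<and>
       (sat_set F \<noteq> {} \<longrightarrow> (\<exists>a\<in>sat_set F. r = SAT a)))"
proof -
  let ?c = "(GGCP_Start (L, V, E), []) :: 'n config"
  have start: "config_ok ?c" "config_sols ?c = sat_set F"
    using is_igs_skew[OF assms(2)] is_igs_sols[OF assms(2)] by (simp_all add: config_defs)
  note inv = solver_step_invariant[OF assms(3)]
  have reach: "config_ok c \<and> config_sols c \<subseteq> sat_set F \<and> (config_sols c = {} \<longrightarrow> sat_set F = {})"
    if "solver_reaches \<sigma> (L, V, E) c" for c
    using that unfolding solver_reaches_def
  proof (induction rule: rtranclp_induct)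
    case (step c c')
    then show ?case using inv[of c c'] by blast
  qed (use start in simp)
  have "\<not> (\<exists>c. c 0 = ?c \<and> (\<forall>k. solver_step \<sigma> (c k) (c (Suc k))))"
  proof
    assume "\<exists>c. c 0 = ?c \<and> (\<forall>k. solver_step \<sigma> (c k) (c (Suc k)))"
    then obtain c where c: "c 0 = ?c" "\<And>k. solver_step \<sigma> (c k) (c (Suc k))" by blast
    have "config_ok (c k)" for k
    proof (induction k)
      case (Suc k)
      then show ?case using inv[OF c(2)] by blast
    qed (simp only: c start)
    then have "config_weight (c (Suc k)) < config_weight (c k)" for k
      using c(2) inv by blast
    then show False using wf_iff_no_infinite_down_chain[of "measure config_weight"] by auto
  qed
  then have "solver_terminates \<sigma> (L, V, E)"
    using solver_step_progress[OF assms(3)] reach by (auto simp: solver_terminates_def)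
  \<comment> \<open>With an empty stack the tracked set is empty for \<open>UNSAT\<close> and the
    returned point alone for \<open>SAT\<close>.\<close>
  moreover have "(r = UNSAT \<longleftrightarrow> sat_set F = {}) \<and> (sat_set F \<noteq> {} \<longrightarrow> (\<exists>a\<in>sat_set F. r = SAT a))"
    if "solver_returns \<sigma> (L, V, E) r" for r
    using reach[of "(Return r, [])"] that
    by (cases r) (auto simp: solver_returns_def config_sols_def)
  ultimately show ?thesis by blast
qed

end
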